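(* Let $G$ be a (not necessarily finite) $n$-centralizer group with $n\in\{4,5,6,7,9\}$. Then $|G'|=n-2$.
   Context: $\mathrm{Cent}(G)=\{C_G(x): x\in G\}$ is the set of centralizers of elements of $G$; $G$ is $n$-centralizer if $|\mathrm{Cent}(G)|=n$. $G'$ is the commutator subgroup of $G$. *)

theory Defs
  imports "HOL-Algebra.Algebra"
begin

definition centralizer :: "('a, 'b) monoid_scheme \<Rightarrow> 'a \<Rightarrow> 'a set"
  where "centralizer G x = {g \<in> carrier G. g \<otimes>\<^bsub>G\<^esub> x = x \<otimes>\<^bsub>G\<^esub> g}"

definition Cent :: "('a, 'b) monoid_scheme \<Rightarrow> 'a set set"
  where "Cent G = {centralizer G x | x. x \<in> carrier G}"

(* Finiteness is explicit because card is 0 on infinite sets. *)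
definition n_centralizer :: "nat \<Rightarrow> ('a, 'b) monoid_scheme \<Rightarrow> bool"
  where "n_centralizer n G \<longleftrightarrow> finite (Cent G) \<and> card (Cent G) = n"

end

theory Submission
  imports Defs
begin

text \<open>If some noncentral element had a nonabelian centralizer, there would be at least ten
  centralizers; hence all centralizers of noncentral elements are abelian, any two of them meet in
  the center \<open>Z\<close>, and they partition \<open>G/Z\<close> into \<open>t = n - 1\<close> subgroups. A nontrivial
  coset of one member of a partition meets each other member at most once, so \<open>G/Z\<close> is finite
  and all members have at most \<open>t - 1\<close> elements. Counting elements and conjugacy classes of members
  shows that for \<open>t = 3, 4, 5, 6, 8\<close> some member \<open>A/Z\<close> has exactly \<open>t - 1\<close> elements. Then
  \<open>A\<close> is normal with an abelian supplement, all commutators lie in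
  \<open>{[a, b] | a. a \<in> A}\<close> for a fixed \<open>b\<close> outside \<open>A\<close>, and this set has
  \<open>|A/Z| = n - 2\<close> elements.\<close>

section \<open>Centralizers\<close>

context group
begin

text \<open>The bound ten is just enough to reach n = 9: sorted by whether they contain x, the
  centralizers forced by a nonabelian centralizer of a noncentral x number at least 5 + 8 or 6 + 4.
  The order of G/Z is not known in advance, but it is determined by the sizes of the t members,
  which are bounded in terms of t. So each t leaves finitely many size distributions, and
  divisibility can be tested on all of them. The gap at n = 8 is a genuine obstacle to this
  argument: the seven subgroups of order 2 of an elementary abelian group of order 8 form a
  partition with t = 7, and none of them has 6 elements. The size t - 1 matters because a coset of
  A/Z other than A/Z itself then has exactly one element in each remaining member. Both the
  normality of A and the comparison of commutators rest on this. As G may be infinite, all counting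
  happens in G/Z, and the finiteness of G' is obtained together with its cardinality from a
  bijection with A/Z.\<close>

lemma inv_mult_cancel:
  assumes "x \<in> carrier G" "y \<in> carrier G"
  shows "inv x \<otimes> (x \<otimes> y) = y" "x \<otimes> (inv x \<otimes> y) = y"
  using assms by (simp_all add: m_assoc[symmetric])

lemma centralizer_iff:
  "y \<in> centralizer G x \<longleftrightarrow> y \<in> carrier G \<and> y \<otimes> x = x \<otimes> y"
  by (auto simp: centralizer_def)

lemma centralizer_sym:
  "x \<in> carrier G \<Longrightarrow> y \<in> centralizer G x \<Longrightarrow> x \<in> centralizer G y"
  by (simp add: centralizer_iff)

lemma self_in_centralizer: "x \<in> carrier G \<Longrightarrow> x \<in> centralizer G x"
  by (simp add: centralizer_iff)

lemma centralizer_subset: "centralizer G x \<subseteq> carrier G"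
  by (auto simp: centralizer_iff)

lemma centralizer_subgroup:
  assumes x: "x \<in> carrier G"
  shows "subgroup (centralizer G x) G"
proof (rule subgroupI)
  show "centralizer G x \<subseteq> carrier G" by (rule centralizer_subset)
  show "centralizer G x \<noteq> {}" using self_in_centralizer[OF x] by blast
next
  fix a assume "a \<in> centralizer G x"
  then have a: "a \<in> carrier G" "a \<otimes> x = x \<otimes> a" by (auto simp: centralizer_iff)
  have "x \<otimes> inv a = inv a \<otimes> (a \<otimes> x) \<otimes> inv a" using a(1) x by (simp add: inv_mult_cancel)
  also have "\<dots> = inv a \<otimes> x" using a(1) x unfolding a(2) by (simp add: m_assoc)
  finally have "inv a \<otimes> x = x \<otimes> inv a" ..
  then show "inv a \<in> centralizer G x" using a by (simp add: centralizer_iff)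
next
  fix a b assume "a \<in> centralizer G x" "b \<in> centralizer G x"
  then have ab: "a \<in> carrier G" "a \<otimes> x = x \<otimes> a" "b \<in> carrier G" "b \<otimes> x = x \<otimes> b"
    by (auto simp: centralizer_iff)
  have "a \<otimes> b \<otimes> x = a \<otimes> (x \<otimes> b)" using ab x by (simp add: m_assoc)
  also have "\<dots> = x \<otimes> (a \<otimes> b)" using ab x by (metis m_assoc)
  finally show "a \<otimes> b \<in> centralizer G x" using ab by (simp add: centralizer_iff)
qed

lemma subgroup_mult_cancel_right:
  assumes "subgroup K G" "h \<in> carrier G" "k \<in> K" "h \<otimes> k \<in> K"
  shows "h \<in> K"
proof -
  have "k \<in> carrier G" using assms subgroup.mem_carrier by metis
  then have "h \<otimes> k \<otimes> inv k = h" using assms by (simp add: m_assoc)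
  then show ?thesis using assms by (metis subgroup.m_closed subgroup.m_inv_closed)
qed

lemma subgroup_mult_cancel_left:
  assumes "subgroup K G" "h \<in> carrier G" "k \<in> K" "k \<otimes> h \<in> K"
  shows "h \<in> K"
proof -
  have "k \<in> carrier G" using assms subgroup.mem_carrier by metis
  then have "inv k \<otimes> (k \<otimes> h) = h" using assms by (simp add: inv_mult_cancel)
  then show ?thesis using assms by (metis subgroup.m_closed subgroup.m_inv_closed)
qed

lemma subgroup_inv_cancel:
  assumes "subgroup K G" "h \<in> carrier G" "inv h \<in> K"
  shows "h \<in> K"
  using assms by (metis inv_inv subgroup.m_inv_closed)

lemma centralizer_one: "centralizer G \<one> = carrier G"
  by (auto simp: centralizer_iff)

lemma centralizer_in_Cent: "x \<in> carrier G \<Longrightarrow> centralizer G x \<in> Cent G"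
  by (auto simp: Cent_def)

lemma centralizer_mono_mult:
  assumes "y \<in> carrier G" "z \<in> carrier G"
    and "K \<subseteq> centralizer G y" "K \<subseteq> centralizer G z"
  shows "K \<subseteq> centralizer G (y \<otimes> z)"
proof
  fix k assume "k \<in> K"
  then have "k \<in> carrier G" "y \<in> centralizer G k" "z \<in> centralizer G k"
    using assms centralizer_sym centralizer_subset by blast+
  then show "k \<in> centralizer G (y \<otimes> z)"
    using centralizer_subgroup subgroup.m_closed centralizer_sym assms m_closed
    by (metis centralizer_iff)
qed

lemma centralizer_mono_inv:
  assumes "y \<in> carrier G" "K \<subseteq> centralizer G y"
  shows "K \<subseteq> centralizer G (inv y)"
proof
  fix k assume "k \<in> K"
  then have "k \<in> carrier G" "y \<in> centralizer G k"
    using assms centralizer_sym centralizer_subset by blast+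
  then show "k \<in> centralizer G (inv y)"
    using centralizer_subgroup subgroup.m_inv_closed centralizer_sym assms
    by (metis centralizer_iff)
qed

section \<open>Lower bounds on the number of centralizers\<close>

text \<open>The five are told apart by g, a and b: \<open>carrier G\<close> and the centralizer of x
  contain both a and b and are separated by g, those of a and b contain exactly one of the two, and
  that of \<open>a \<otimes> b\<close> contains neither. A centralizer with a but without b can thus
  coincide only with that of a, which is how a sixth one is recognized.\<close>

lemma five_centralizers_containing:
  assumes x: "x \<in> carrier G" and g: "g \<in> carrier G" "g \<notin> centralizer G x"
    and ab: "a \<in> centralizer G x" "b \<in> centralizer G x" "a \<notin> centralizer G b"
  defines "I5 \<equiv> {carrier G, centralizer G x, centralizer G a, centralizer G b, centralizer G (a \<otimes> b)}"
  shows "I5 \<subseteq> {c \<in> Cent G. x \<in> c}" "card I5 = 5"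
    "\<And>v. v \<in> centralizer G x \<Longrightarrow> a \<in> centralizer G v \<Longrightarrow> b \<notin> centralizer G v \<Longrightarrow>
       centralizer G v \<noteq> centralizer G a \<Longrightarrow> centralizer G v \<notin> I5"
proof -
  have c: "a \<in> carrier G" "b \<in> carrier G" using ab centralizer_subset by auto
  have in_x: "x \<in> centralizer G y" if "y \<in> centralizer G x" for y
    using that centralizer_sym x by blast
  have abx: "a \<otimes> b \<in> centralizer G x"
    by (rule subgroup.m_closed[OF centralizer_subgroup[OF x] ab(1,2)])
  show "I5 \<subseteq> {c \<in> Cent G. x \<in> c}"
  proof -
    have "carrier G \<in> Cent G" using centralizer_in_Cent[OF one_closed] by (simp add: centralizer_one)
    then show ?thesis
      unfolding I5_def using in_x[OF ab(1)] in_x[OF ab(2)] in_x[OF abx] x c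
        self_in_centralizer[OF x] by (simp add: centralizer_in_Cent)
  qed
  have aa: "a \<in> centralizer G a" "b \<in> centralizer G b" using c self_in_centralizer by auto
  have ba: "b \<notin> centralizer G a" using ab c centralizer_sym by blast
  have a_ab: "a \<notin> centralizer G (a \<otimes> b)"
  proof
    assume "a \<in> centralizer G (a \<otimes> b)"
    then have "a \<otimes> b \<in> centralizer G a" using c centralizer_sym by blast
    then have "b \<in> centralizer G a"
      using subgroup_mult_cancel_left[OF centralizer_subgroup] c aa by blast
    then show False using ba by blast
  qed
  have b_ab: "b \<notin> centralizer G (a \<otimes> b)"
  proof
    assume "b \<in> centralizer G (a \<otimes> b)"
    then have "a \<otimes> b \<in> centralizer G b" using c centralizer_sym by blast
    then have "a \<in> centralizer G b"
      using subgroup_mult_cancel_right[OF centralizer_subgroup] c aa by blast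
    then show False using ab by blast
  qed
  show "card I5 = 5"
  proof -
    have "carrier G \<noteq> centralizer G x" "carrier G \<noteq> centralizer G a" "carrier G \<noteq> centralizer G b"
      "carrier G \<noteq> centralizer G (a \<otimes> b)" "centralizer G x \<noteq> centralizer G a"
      "centralizer G x \<noteq> centralizer G b" "centralizer G x \<noteq> centralizer G (a \<otimes> b)"
      "centralizer G a \<noteq> centralizer G b" "centralizer G a \<noteq> centralizer G (a \<otimes> b)"
      "centralizer G b \<noteq> centralizer G (a \<otimes> b)"
      using a_ab b_ab aa ba ab g c by blast+
    then show ?thesis unfolding I5_def by simp
  qed
  show "centralizer G v \<notin> I5" if "v \<in> centralizer G x" "a \<in> centralizer G v"
    "b \<notin> centralizer G v" "centralizer G v \<noteq> centralizer G a" for v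
    unfolding I5_def using that a_ab b_ab aa ba ab g c by auto
qed

text \<open>The eight elements \<open>g s e\<close> with \<open>s \<in> {1, a, b, ab}\<close> and \<open>e \<in> {1, x}\<close> have centralizers that
  do not contain \<open>x\<close>. No three of these centralizers coincide, and if two do, then the quotient \<open>w\<close>
  of the two elements yields a sixth centralizer containing \<open>x\<close>, that of \<open>w x\<close>.\<close>

lemma nonabelian_centralizer_bound:
  assumes fin: "finite (Cent G)"
    and x: "x \<in> carrier G" and g: "g \<in> carrier G" "g \<notin> centralizer G x"
    and ab: "a \<in> centralizer G x" "b \<in> centralizer G x" "a \<notin> centralizer G b"
  shows "10 \<le> card (Cent G)"
proof -
  define I where "I = {c \<in> Cent G. x \<in> c}"
  define J where "J = {c \<in> Cent G. x \<notin> c}"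
  have finIJ: "finite I" "finite J" using fin by (auto simp: I_def J_def)
  have "Cent G = I \<union> J" "I \<inter> J = {}" by (auto simp: I_def J_def)
  then have card_Cent: "card (Cent G) = card I + card J"
    using finIJ card_Un_disjoint by metis
  let ?H = "centralizer G x"
  have H: "subgroup ?H G" using centralizer_subgroup[OF x] .
  have Hc: "h \<in> carrier G" if "h \<in> ?H" for h using that centralizer_subset by blast
  have c: "a \<in> carrier G" "b \<in> carrier G" using ab Hc by auto
  have ba: "b \<notin> centralizer G a" using ab c centralizer_sym by blast
  define S where "S = {\<one>, a, b, a \<otimes> b}"
  define E where "E = {\<one>, x}"
  have SH: "S \<subseteq> ?H" unfolding S_def using ab H subgroup.one_closed subgroup.m_closed by fastforce
  have EH: "E \<subseteq> ?H" unfolding E_def using H subgroup.one_closed self_in_centralizer[OF x] by fastforce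
  have Sc: "s \<in> carrier G" if "s \<in> S" for s using that SH Hc by blast
  have Ec: "e \<in> carrier G" if "e \<in> E" for e using that EH Hc by blast
  have ab_ne: "a \<noteq> \<one>" "b \<noteq> \<one>" "a \<noteq> b" "a \<otimes> b \<noteq> \<one>" "a \<otimes> b \<noteq> a" "a \<otimes> b \<noteq> b"
    using ab c inv_comm[of a b] by (auto simp: centralizer_iff)
  have xne: "x \<noteq> \<one>" using g by (auto simp: centralizer_one)
  have cardSE: "card (S \<times> E) = 8"
    using ab_ne xne unfolding S_def E_def card_cartesian_product by auto
  define u where "u = (\<lambda>(s, e). g \<otimes> s \<otimes> e)"
  define F where "F = (\<lambda>p. centralizer G (u p))"
  have uc: "u p \<in> carrier G" if "p \<in> S \<times> E" for p
    using that Sc Ec g by (auto simp: u_def)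
  have notH: "u p \<notin> ?H" if p: "p \<in> S \<times> E" for p
  proof
    assume "u p \<in> ?H"
    moreover obtain s e where se: "p = (s, e)" "s \<in> ?H" "e \<in> ?H" using p SH EH by blast
    ultimately have "g \<otimes> s \<in> ?H"
      using subgroup_mult_cancel_right[OF H, of "g \<otimes> s" e] g Hc[of s] by (simp add: u_def)
    then show False using subgroup_mult_cancel_right[OF H, of g s] g se by blast
  qed
  have xF: "x \<notin> F p" if "p \<in> S \<times> E" for p
    using notH[OF that] uc[OF that] centralizer_sym x unfolding F_def by blast
  have FJ: "F ` (S \<times> E) \<subseteq> J"
    using xF uc centralizer_in_Cent by (auto simp: F_def J_def)
  \<comment> \<open>If \<open>F p = F q\<close>, both elements lie in this common centralizer. Their
    quotient then lies in it too, and all of it commutes with the quotient.\<close>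
  define v where "v = (\<lambda>p q. inv (u p) \<otimes> u q)"
  have F_sub: "F p \<subseteq> centralizer G (v p q)" if "p \<in> S \<times> E" "q \<in> S \<times> E" "F p = F q" for p q
    unfolding v_def using that uc
    by (intro centralizer_mono_mult centralizer_mono_inv) (auto simp: F_def)
  have v_mem: "v p q \<in> F p" if "p \<in> S \<times> E" "q \<in> S \<times> E" "F p = F q" for p q
    using that uc centralizer_subgroup[OF uc] self_in_centralizer[OF uc]
    unfolding v_def F_def by (metis subgroup.m_closed subgroup.m_inv_closed)
  \<comment> \<open>Factors coming from E are central in \<open>?H\<close>, so up to such a factor
    \<open>v\<close> is the quotient of the first components.\<close>
  have v_eq: "v (s, e) (s', e') = inv s \<otimes> s' \<otimes> (inv e \<otimes> e')"
    and e_central: "?H \<subseteq> centralizer G (inv e \<otimes> e')"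
    if se: "s \<in> S" "e \<in> E" "s' \<in> S" "e' \<in> E" for s e s' e'
  proof -
    have HE: "?H \<subseteq> centralizer G d" if "d \<in> E" for d
      using that Hc by (auto simp: E_def centralizer_one)
    show "?H \<subseteq> centralizer G (inv e \<otimes> e')"
      using se HE EH Hc by (intro centralizer_mono_mult centralizer_mono_inv) auto
    have cs: "s \<in> carrier G" "e \<in> carrier G" "s' \<in> carrier G" "e' \<in> carrier G"
      using se Sc Ec by auto
    have "inv s \<otimes> s' \<in> ?H"
      using se SH H subgroup.m_closed subgroup.m_inv_closed by (metis subsetD)
    then have "inv s \<otimes> s' \<in> centralizer G (inv e)"
      using centralizer_mono_inv[OF cs(2) HE[OF se(2)]] by blast
    then have *: "inv s \<otimes> s' \<otimes> inv e = inv e \<otimes> (inv s \<otimes> s')" by (simp add: centralizer_iff)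
    have "v (s, e) (s', e') = inv e \<otimes> (inv s \<otimes> s') \<otimes> e'"
      using cs g by (simp add: v_def u_def inv_mult_group m_assoc inv_mult_cancel)
    also have "\<dots> = inv s \<otimes> s' \<otimes> (inv e \<otimes> e')"
      using cs by (simp add: *[symmetric] m_assoc)
    finally show "v (s, e) (s', e') = inv s \<otimes> s' \<otimes> (inv e \<otimes> e')" .
  qed
  have drop_e: "h \<in> centralizer G (inv s \<otimes> s')"
    if "s \<in> S" "e \<in> E" "s' \<in> S" "e' \<in> E" "h \<in> ?H" "h \<in> centralizer G (v (s, e) (s', e'))"
    for s e s' e' h
  proof -
    have cs: "s \<in> carrier G" "e \<in> carrier G" "s' \<in> carrier G" "e' \<in> carrier G" "h \<in> carrier G"
      using that Sc Ec Hc by auto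
    have "inv s \<otimes> s' \<otimes> (inv e \<otimes> e') \<in> centralizer G h" "inv e \<otimes> e' \<in> centralizer G h"
      using that v_eq[of s e s' e'] e_central[of s e s' e'] cs centralizer_sym by auto
    then have "inv s \<otimes> s' \<in> centralizer G h"
      using subgroup_mult_cancel_right[OF centralizer_subgroup[of h], of "inv s \<otimes> s'" "inv e \<otimes> e'"]
        cs by simp
    then show ?thesis using cs centralizer_sym by blast
  qed
  have vH: "v p q \<in> ?H" if "p \<in> S \<times> E" "q \<in> S \<times> E" for p q
  proof -
    obtain s e s' e' where "p = (s, e)" "q = (s', e')" "s \<in> ?H" "e \<in> ?H" "s' \<in> ?H" "e' \<in> ?H"
      "s \<in> S" "e \<in> E" "s' \<in> S" "e' \<in> E"
      using \<open>p \<in> S \<times> E\<close> \<open>q \<in> S \<times> E\<close> SH EH by blast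
    then show ?thesis using v_eq H by (metis subgroup.m_closed subgroup.m_inv_closed)
  qed
  \<comment> \<open>With equal first components the quotient would be x or its inverse, but no
    \<open>F p\<close> contains x.\<close>
  have fst_inj: "e = e'" if "(s, e) \<in> S \<times> E" "(s, e') \<in> S \<times> E" "F (s, e) = F (s, e')" for s e e'
  proof (rule ccontr)
    assume ne: "e \<noteq> e'"
    have "v (s, e) (s, e') \<in> F (s, e)" using v_mem that by blast
    moreover have "v (s, e) (s, e') = inv e \<otimes> e'"
      using v_eq[of s e s e'] that Sc Ec by auto
    moreover have "e = \<one> \<and> e' = x \<or> e = x \<and> e' = \<one>" using ne that by (auto simp: E_def)
    ultimately have "x \<in> F (s, e)"
      using x subgroup_inv_cancel[OF centralizer_subgroup[OF uc[OF that(1)]], of x]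
      by (auto simp: F_def)
    then show False using xF that by blast
  qed
  \<comment> \<open>One quotient lies in the common centralizer, which is contained in the
    centralizer of the other quotient. So the two commute, and the parts from E drop out.\<close>
  have triple: "inv s \<otimes> s1 \<in> centralizer G (inv s \<otimes> s2)"
    if "(s, e) \<in> S \<times> E" "(s1, e1) \<in> S \<times> E" "(s2, e2) \<in> S \<times> E"
      "F (s, e) = F (s1, e1)" "F (s, e) = F (s2, e2)" for s e s1 e1 s2 e2
  proof -
    have cs: "inv s \<otimes> s1 \<in> carrier G" "inv s \<otimes> s2 \<in> carrier G" using that Sc by auto
    have S3: "s \<in> S" "e \<in> E" "s1 \<in> S" "e1 \<in> E" "s2 \<in> S" "e2 \<in> E" using that by auto
    have "v (s, e) (s1, e1) \<in> centralizer G (v (s, e) (s2, e2))"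
      using F_sub[OF that(1,3,5)] v_mem[OF that(1,2,4)] by blast
    then have "v (s, e) (s1, e1) \<in> centralizer G (inv s \<otimes> s2)"
      using drop_e[OF S3(1,2,5,6)] vH[OF that(1,2)] by simp
    then have "inv s \<otimes> s2 \<in> centralizer G (v (s, e) (s1, e1))"
      using cs by (metis centralizer_sym)
    moreover have "inv s \<otimes> s2 \<in> ?H"
      using S3 subsetD[OF SH] subgroup.m_closed[OF H] subgroup.m_inv_closed[OF H] by simp
    ultimately have "inv s \<otimes> s2 \<in> centralizer G (inv s \<otimes> s1)"
      using drop_e[OF S3(1-4)] by simp
    then show ?thesis using cs by (metis centralizer_sym)
  qed
  have ab_ab: "a \<notin> centralizer G (a \<otimes> b)" "b \<notin> centralizer G (a \<otimes> b)" "inv a \<otimes> b \<notin> centralizer G b"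
  proof -
    show "a \<notin> centralizer G (a \<otimes> b)"
      using c ba centralizer_sym subgroup_mult_cancel_left[OF centralizer_subgroup[of a]]
        self_in_centralizer by blast
    show "b \<notin> centralizer G (a \<otimes> b)"
      using c ab centralizer_sym subgroup_mult_cancel_right[OF centralizer_subgroup[of b]]
        self_in_centralizer by blast
    show "inv a \<otimes> b \<notin> centralizer G b"
      using c ab subgroup_mult_cancel_right[OF centralizer_subgroup[of b]]
        self_in_centralizer subgroup_inv_cancel[OF centralizer_subgroup[of b]] by blast
  qed
  have fibre: "card {p \<in> S \<times> E. F p = y} \<le> 2" for y
  proof -
    define P where "P = {p \<in> S \<times> E. F p = y}"
    have finS: "finite S" "finite (S \<times> E)" by (auto simp: S_def E_def)
    have inj: "inj_on fst P"
      using fst_inj by (auto simp: inj_on_def P_def)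
    have trip: "inv s \<otimes> s1 \<in> centralizer G (inv s \<otimes> s2)"
      if "s \<in> fst ` P" "s1 \<in> fst ` P" "s2 \<in> fst ` P" for s s1 s2
      using that triple by (fastforce simp: P_def)
    have abb: "inv a \<otimes> (a \<otimes> b) = b" using c by (simp add: inv_mult_cancel)
    \<comment> \<open>Any three elements of S have noncommuting quotients relative to one of them: a
      and b, a and ab, b and ab, or \<open>inv a \<otimes> b\<close> and b.\<close>
    have n: "\<not> {\<one>, a, b} \<subseteq> fst ` P" "\<not> {\<one>, a, a \<otimes> b} \<subseteq> fst ` P"
      "\<not> {\<one>, b, a \<otimes> b} \<subseteq> fst ` P" "\<not> {a, b, a \<otimes> b} \<subseteq> fst ` P"
      using trip[of \<one> a b] trip[of \<one> a "a \<otimes> b"] trip[of \<one> b "a \<otimes> b"] trip[of a b "a \<otimes> b"]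
        ab ab_ab abb c by auto
    have sub: "fst ` P \<subseteq> S" by (auto simp: P_def)
    have "card (fst ` P) \<le> 2"
    proof (rule ccontr)
      assume "\<not> ?thesis"
      then have "card (S - fst ` P) \<le> 1"
        using card_Diff_subset[of "fst ` P" S] sub finS finite_subset[OF sub finS(1)] ab_ne
        by (simp add: S_def)
      then have "\<exists>z. S - fst ` P \<subseteq> {z}"
        using finS by (metis card_le_Suc0_iff_eq finite_Diff One_nat_def insertCI subsetI singletonI)
      then show False using n ab_ne by (auto simp: S_def)
    qed
    then show ?thesis using card_image[OF inj] by (simp add: P_def)
  qed
  have J4: "4 \<le> card J"
  proof -
    have un: "(\<Union>y\<in>J. {p \<in> S \<times> E. F p = y}) = S \<times> E" using FJ by auto
    have "8 \<le> (\<Sum>y\<in>J. card {p \<in> S \<times> E. F p = y})"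
      using card_UN_le[OF finIJ(2), of "\<lambda>y. {p \<in> S \<times> E. F p = y}"]
      unfolding un cardSE .
    also have "\<dots> \<le> (\<Sum>y\<in>J. 2)" by (intro sum_mono fibre)
    finally show ?thesis by simp
  qed
  show ?thesis
  proof (cases "inj_on F (S \<times> E)")
    case True
    then have "8 \<le> card J" using FJ cardSE finIJ by (metis card_inj_on_le)
    moreover have "5 \<le> card I"
      using card_mono[OF finIJ(1) five_centralizers_containing(1)[OF x g ab, folded I_def]]
        five_centralizers_containing(2)[OF x g ab] by simp
    ultimately show ?thesis using card_Cent by linarith
  next
    case False
    then obtain p q where pq: "p \<in> S \<times> E" "q \<in> S \<times> E" "p \<noteq> q" "F p = F q"
      by (auto simp: inj_on_def)
    obtain s e s' e' where se: "p = (s, e)" "q = (s', e')" by fastforce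
    have ss: "s \<noteq> s'" using pq se fst_inj by blast
    have S2: "s \<in> S" "s' \<in> S" "e \<in> E" "e' \<in> E" using pq se by auto
    define w where "w = v p q"
    have wH: "w \<in> ?H" using vH pq w_def by blast
    have cs: "s \<in> carrier G" "s' \<in> carrier G" using S2 Sc by auto
    \<comment> \<open>Once w fails to commute with a or with b, the pair of w and that element can
      replace a and b in \<open>five_centralizers_containing\<close>.\<close>
    have noncentral: "\<not> (a \<in> centralizer G w \<and> b \<in> centralizer G w)"
    proof
      assume *: "a \<in> centralizer G w \<and> b \<in> centralizer G w"
      then have **: "a \<in> centralizer G (inv s \<otimes> s')" "b \<in> centralizer G (inv s \<otimes> s')"
        using drop_e[of s e s' e'] S2 ab unfolding w_def se by auto
      have ia: "inv s \<otimes> s' \<in> centralizer G a" and ib: "inv s \<otimes> s' \<in> centralizer G b"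
        using ** cs centralizer_sym by auto
      have A: "subgroup (centralizer G a) G" "subgroup (centralizer G b) G"
        using c centralizer_subgroup by auto
      have aa: "a \<in> centralizer G a" "b \<in> centralizer G b" using c self_in_centralizer by auto
      have sym: "inv s' \<otimes> s \<in> K" if "subgroup K G" "inv s \<otimes> s' \<in> K" for K
        using that subgroup.m_inv_closed[OF that] cs by (simp add: inv_mult_group)
      \<comment> \<open>One ordered pair for each two-element subset of S is enough, since reversing
        a pair inverts the quotient.\<close>
      define R where "R = {(\<one>, a), (\<one>, b), (\<one>, a \<otimes> b), (a, b), (a, a \<otimes> b), (b, a \<otimes> b)}"
      have no: "\<not> (inv t \<otimes> t' \<in> centralizer G a \<and> inv t \<otimes> t' \<in> centralizer G b)"
        if "(t, t') \<in> R" for t t'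
      proof -
        have "inv b \<otimes> (a \<otimes> b) \<notin> centralizer G b"
          using subgroup_mult_cancel_left[OF A(2), of "a \<otimes> b" "inv b"]
            subgroup_mult_cancel_right[OF A(2), of a b] subgroup.m_inv_closed[OF A(2)] aa ab c by auto
        moreover have "a \<otimes> b \<notin> centralizer G a"
          using ab_ab c centralizer_sym by blast
        moreover have "inv a \<otimes> (a \<otimes> b) = b" using c by (simp add: inv_mult_cancel)
        ultimately show ?thesis using that ab ba ab_ab c by (auto simp: R_def)
      qed
      have "(s, s') \<in> R \<or> (s', s) \<in> R"
        using S2 ss by (auto simp: S_def R_def)
      then show False using no[of s s'] no[of s' s] ia ib sym[OF A(1) ia] sym[OF A(2) ib] by blast
    qed
    have "w \<notin> centralizer G a \<or> w \<notin> centralizer G b"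
      using noncentral centralizer_sym[OF c(1)] centralizer_sym[OF c(2)] by blast
    then obtain w' where w': "w' \<in> ?H" "w \<notin> centralizer G w'" using ab by blast
    have xc: "x \<in> centralizer G x" using self_in_centralizer x by blast
    have wx: "w \<otimes> x \<in> ?H" by (rule subgroup.m_closed[OF H wH xc])
    have w_wx: "w \<in> centralizer G (w \<otimes> x)"
      using centralizer_mono_mult[of w x "{w}"] self_in_centralizer wH Hc x by auto
    have w'_wx: "w' \<notin> centralizer G (w \<otimes> x)"
    proof
      assume "w' \<in> centralizer G (w \<otimes> x)"
      then have "w \<otimes> x \<in> centralizer G w'" using wx Hc centralizer_sym by blast
      moreover have "x \<in> centralizer G w'" using w' x centralizer_sym by blast
      ultimately show False
        using subgroup_mult_cancel_right[OF centralizer_subgroup[of w'], of w x] w' wH Hc by simp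
    qed
    \<comment> \<open>The element \<open>u p\<close> separates the two: it commutes with w, so
      commuting with \<open>w \<otimes> x\<close> as well would make it commute with x.\<close>
    have neq: "centralizer G (w \<otimes> x) \<noteq> centralizer G w"
    proof
      assume eq: "centralizer G (w \<otimes> x) = centralizer G w"
      have "u p \<in> F p" using self_in_centralizer[OF uc[OF pq(1)]] unfolding F_def .
      then have "u p \<in> centralizer G w" using F_sub pq w_def by blast
      then have "w \<in> centralizer G (u p)" "w \<otimes> x \<in> centralizer G (u p)"
        using eq centralizer_sym wH wx Hc by auto
      then have "x \<in> centralizer G (u p)"
        using subgroup_mult_cancel_left[OF centralizer_subgroup[of "u p"], of x w] uc pq x by simp
      then show False using xF pq by (simp add: F_def)
    qed
    note five = five_centralizers_containing[OF x g wH w'(1) w'(2)]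
    have "centralizer G (w \<otimes> x) \<in> I"
      using centralizer_sym[OF x wx] centralizer_in_Cent[OF Hc[OF wx]] by (simp add: I_def)
    then have "insert (centralizer G (w \<otimes> x)) {carrier G, centralizer G x, centralizer G w,
        centralizer G w', centralizer G (w \<otimes> w')} \<subseteq> I"
      using five(1)[folded I_def] by (rule insert_subsetI)
    from card_mono[OF finIJ(1) this] have "6 \<le> card I"
      using five(2) five(3)[OF wx w_wx w'_wx neq] by (subst (asm) card_insert_disjoint) simp_all
    then show ?thesis using J4 card_Cent by linarith
  qed
qed

end

section \<open>Partitions of a group into subgroups\<close>

text \<open>Finiteness is assumed of the family only; that of the group is derived. Closure under
  conjugation is what allows members to be counted by conjugacy classes.\<close>

locale group_partition = group G for G (structure) +
  fixes P :: "'a set set"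
  assumes finite_parts: "finite P"
    and part_subgroup: "S \<in> P \<Longrightarrow> subgroup S G"
    and part_nontrivial: "S \<in> P \<Longrightarrow> S \<noteq> {\<one>}"
    and part_proper: "S \<in> P \<Longrightarrow> S \<noteq> carrier G"
    and parts_cover: "\<Union>P = carrier G"
    and parts_disjoint: "S \<in> P \<Longrightarrow> T \<in> P \<Longrightarrow> S \<noteq> T \<Longrightarrow> S \<inter> T = {\<one>}"
    and parts_conjugate: "g \<in> carrier G \<Longrightarrow> S \<in> P \<Longrightarrow> g <# S #> inv g \<in> P"
begin

lemma part_carrier: "S \<in> P \<Longrightarrow> s \<in> S \<Longrightarrow> s \<in> carrier G"
  using part_subgroup subgroup.mem_carrier by fast

text \<open>In the quotient of the two points g cancels, and what remains,
  \<open>s \<otimes> inv s'\<close>, lies in both members.\<close>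

lemma coset_meets_part_once:
  assumes "S \<in> P" "T \<in> P" "S \<noteq> T" "g \<in> carrier G" "s \<in> S" "s' \<in> S"
    and "s \<otimes> g \<in> T" "s' \<otimes> g \<in> T"
  shows "s = s'"
proof -
  have c: "s \<in> carrier G" "s' \<in> carrier G" using assms part_carrier by auto
  have "(s \<otimes> g) \<otimes> inv (s' \<otimes> g) \<in> T"
    using assms part_subgroup[of T] by (simp add: subgroup.m_closed subgroup.m_inv_closed)
  moreover have "(s \<otimes> g) \<otimes> inv (s' \<otimes> g) = s \<otimes> inv s'"
    using c assms(4) by (simp add: inv_mult_group m_assoc inv_mult_cancel)
  moreover have "s \<otimes> inv s' \<in> S"
    using assms part_subgroup[of S] by (simp add: subgroup.m_closed subgroup.m_inv_closed)
  ultimately have "s \<otimes> inv s' = \<one>" using parts_disjoint[OF assms(1-3)] by auto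
  then show ?thesis using c by (metis inv_equality inv_inv inv_closed)
qed

text \<open>The injection itself is kept, not just an inequality: it yields the finiteness of S as
  well as the bound, and in the extremal case its surjectivity is needed.\<close>

lemma part_coset_parts:
  assumes S: "S \<in> P" and g: "g \<in> carrier G" "g \<notin> S"
  obtains f where "inj_on f S" "f ` S \<subseteq> P - {S}" "\<And>s. s \<in> S \<Longrightarrow> s \<otimes> g \<in> f s"
proof -
  have "\<exists>T. T \<in> P - {S} \<and> s \<otimes> g \<in> T" if s: "s \<in> S" for s
  proof -
    have "s \<otimes> g \<in> carrier G" using part_carrier[OF S s] g by simp
    then obtain T where T: "T \<in> P" "s \<otimes> g \<in> T" using parts_cover by blast
    moreover have "T \<noteq> S"
      using subgroup_mult_cancel_left[OF part_subgroup[OF S] g(1) s] g T by blast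
    ultimately show ?thesis by blast
  qed
  then obtain f where f: "\<And>s. s \<in> S \<Longrightarrow> f s \<in> P - {S} \<and> s \<otimes> g \<in> f s" by metis
  have "inj_on f S"
  proof (rule inj_onI)
    fix s s' assume "s \<in> S" "s' \<in> S" "f s = f s'"
    then show "s = s'" using coset_meets_part_once[OF S, of "f s" g s s'] f g by auto
  qed
  then show ?thesis using f that by blast
qed

lemma part_finite_card_le:
  assumes S: "S \<in> P"
  shows "finite S" "card S \<le> card P - 1"
proof -
  have "S \<subseteq> carrier G" using part_carrier[OF S] by blast
  then obtain g where g: "g \<in> carrier G" "g \<notin> S" using part_proper[OF S] by blast
  from part_coset_parts[OF S g] obtain f where f: "inj_on f S" "f ` S \<subseteq> P - {S}" by metis
  have fin: "finite (P - {S})" using finite_parts by simp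
  show "finite S" using inj_on_finite[OF f fin] .
  show "card S \<le> card P - 1" using card_inj_on_le[OF f fin] S finite_parts by simp
qed

lemma part_coset_meets_all:
  assumes S: "S \<in> P" and card: "card S = card P - 1"
    and T: "T \<in> P" "T \<noteq> S" and g: "g \<in> carrier G" "g \<notin> S"
  shows "\<exists>s\<in>S. s \<otimes> g \<in> T"
proof -
  from part_coset_parts[OF S g] obtain f where
    f: "inj_on f S" "f ` S \<subseteq> P - {S}" "\<And>s. s \<in> S \<Longrightarrow> s \<otimes> g \<in> f s" by metis
  have "card (f ` S) = card (P - {S})" using card_image[OF f(1)] card S finite_parts by simp
  then have "f ` S = P - {S}" using card_subset_eq[OF _ f(2)] finite_parts by simp
  then have "T \<in> f ` S" using T by simp
  then obtain s where "s \<in> S" "T = f s" by (rule imageE)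
  then show ?thesis using f(3)[of s] by blast
qed

lemma finite_carrier: "finite (carrier G)"
  using finite_parts part_finite_card_le(1) parts_cover finite_Union by metis

lemma order_eq_sum: "order G = 1 + (\<Sum>S\<in>P. card S - 1)"
proof -
  have one: "\<one> \<in> S" if "S \<in> P" for S using part_subgroup[OF that] by (rule subgroup.one_closed)
  have "carrier G - {\<one>} = (\<Union>S\<in>P. S - {\<one>})" using parts_cover by auto
  moreover have "card (\<Union>S\<in>P. S - {\<one>}) = (\<Sum>S\<in>P. card (S - {\<one>}))"
  proof (rule card_UN_disjoint)
    show "\<forall>S\<in>P. \<forall>T\<in>P. S \<noteq> T \<longrightarrow> (S - {\<one>}) \<inter> (T - {\<one>}) = {}"
      using parts_disjoint by blast
  qed (use finite_parts part_finite_card_le in auto)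
  moreover have "(\<Sum>S\<in>P. card (S - {\<one>})) = (\<Sum>S\<in>P. card S - 1)"
    using one by (intro sum.cong) auto
  ultimately have "card (carrier G - {\<one>}) = (\<Sum>S\<in>P. card S - 1)" by simp
  moreover have "order G = Suc (card (carrier G - {\<one>}))"
    unfolding order_def using card.remove[OF finite_carrier one_closed] by simp
  ultimately show ?thesis by simp
qed

text \<open>As S normalizes T, the product \<open>S <#> T\<close> is a subgroup. Its cardinality is
  the product of the two because the members meet trivially, so Lagrange applies.\<close>

lemma normalizing_parts_card_dvd:
  assumes S: "S \<in> P" and T: "T \<in> P" and ne: "S \<noteq> T"
    and norm: "\<And>s. s \<in> S \<Longrightarrow> s <# T #> inv s = T"
  shows "card S * card T dvd order G"
proof -
  have sS: "subgroup S G" and sT: "subgroup T G" using S T part_subgroup by auto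
  have Sc: "s \<in> carrier G" if "s \<in> S" for s using part_carrier[OF S that] .
  have Tc: "t \<in> carrier G" if "t \<in> T" for t using part_carrier[OF T that] .
  have conj: "s \<otimes> t \<otimes> inv s \<in> T" if "s \<in> S" "t \<in> T" for s t
    using norm[OF that(1)] that(2) unfolding l_coset_def r_coset_def by blast
  define K where "K = S <#> T"
  have KI: "s \<otimes> t \<in> K" if "s \<in> S" "t \<in> T" for s t
    using that unfolding K_def set_mult_def by blast
  have KE: "\<exists>s\<in>S. \<exists>t\<in>T. h = s \<otimes> t" if "h \<in> K" for h
    using that unfolding K_def set_mult_def by blast
  have TS: "t \<otimes> s \<in> K" if "s \<in> S" "t \<in> T" for s t
  proof -
    have "inv s \<otimes> t \<otimes> inv (inv s) \<in> T"
      using conj[OF _ that(2)] subgroup.m_inv_closed[OF sS that(1)] by blast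
    then have "s \<otimes> (inv s \<otimes> t \<otimes> s) \<in> K" using KI that Sc by simp
    then show ?thesis using Sc Tc that by (simp add: m_assoc inv_mult_cancel)
  qed
  have sK: "subgroup K G"
  proof (rule subgroupI)
    show "K \<subseteq> carrier G" using KE Sc Tc by blast
    show "K \<noteq> {}" using KI subgroup.one_closed[OF sS] subgroup.one_closed[OF sT] by blast
    show "inv h \<in> K" if "h \<in> K" for h
    proof -
      obtain s t where st: "s \<in> S" "t \<in> T" "h = s \<otimes> t" using KE \<open>h \<in> K\<close> by blast
      then have "inv h = inv t \<otimes> inv s" using Sc Tc by (simp add: inv_mult_group)
      then show ?thesis
        using TS st subgroup.m_inv_closed[OF sS] subgroup.m_inv_closed[OF sT] by simp
    qed
    show "h \<otimes> h' \<in> K" if "h \<in> K" "h' \<in> K" for h h'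
    proof -
      obtain s t s' t' where st: "s \<in> S" "t \<in> T" "h = s \<otimes> t" "s' \<in> S" "t' \<in> T" "h' = s' \<otimes> t'"
        using KE \<open>h \<in> K\<close> \<open>h' \<in> K\<close> by blast
      obtain s2 t2 where st2: "s2 \<in> S" "t2 \<in> T" "t \<otimes> s' = s2 \<otimes> t2" using TS[of s' t] KE st by blast
      have "h \<otimes> h' = s \<otimes> (t \<otimes> s') \<otimes> t'" using st Sc Tc by (simp add: m_assoc)
      also have "\<dots> = (s \<otimes> s2) \<otimes> (t2 \<otimes> t')" unfolding st2(3) using st st2 Sc Tc by (simp add: m_assoc)
      finally show ?thesis
        using KI subgroup.m_closed[OF sS] subgroup.m_closed[OF sT] st st2 by simp
    qed
  qed
  have "inj_on (\<lambda>(s, t). s \<otimes> t) (S \<times> T)"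
  proof (rule inj_onI, clarsimp)
    fix s t s' t' assume st: "s \<in> S" "t \<in> T" "s' \<in> S" "t' \<in> T" "s \<otimes> t = s' \<otimes> t'"
    have "inv s' \<otimes> s = t' \<otimes> inv t"
      using st Sc Tc by (metis inv_closed inv_solve_left inv_solve_right m_assoc m_closed)
    then have "inv s' \<otimes> s \<in> S \<inter> T"
      using st by (metis IntI sS sT subgroup.m_closed subgroup.m_inv_closed)
    then have "inv s' \<otimes> s = \<one>" using parts_disjoint[OF S T ne] by blast
    then have "s = s'" using st Sc by (metis inv_equality inv_inv inv_closed)
    then show "s = s' \<and> t = t'" using st Sc Tc by simp
  qed
  moreover have "K = (\<lambda>(s, t). s \<otimes> t) ` (S \<times> T)"
    unfolding K_def set_mult_def by auto
  ultimately have "card K = card S * card T" by (simp add: card_image card_cartesian_product)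
  then show ?thesis using lagrange[OF sK] by (metis dvd_triv_right)
qed

section \<open>Conjugacy classes of members\<close>

definition conj_class :: "'a set \<Rightarrow> 'a set set" where
  "conj_class S = {g <# S #> inv g | g. g \<in> carrier G}"

lemma conj_conj:
  assumes "g \<in> carrier G" "h \<in> carrier G" "S \<subseteq> carrier G"
  shows "g <# (h <# S #> inv h) #> inv g = (g \<otimes> h) <# S #> inv (g \<otimes> h)"
proof -
  have "g <# (h <# S #> inv h) = (g <# (h <# S)) #> inv h"
    using assms by (simp add: coset_assoc l_coset_subset_G)
  then show ?thesis
    using assms by (simp add: lcos_m_assoc inv_mult_group coset_mult_assoc l_coset_subset_G)
qed

lemma part_subset: "S \<in> P \<Longrightarrow> S \<subseteq> carrier G"
  using part_carrier by blast

lemma conj_one: "S \<subseteq> carrier G \<Longrightarrow> \<one> <# S #> inv \<one> = S"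
  by (simp add: lcos_mult_one)

lemma conj_class_refl: "S \<in> P \<Longrightarrow> S \<in> conj_class S"
  unfolding conj_class_def using conj_one part_subset by blast

lemma conj_class_closed:
  assumes "S \<in> P" "T \<in> conj_class S" "g \<in> carrier G"
  shows "g <# T #> inv g \<in> conj_class S"
proof -
  obtain h where h: "h \<in> carrier G" "T = h <# S #> inv h" using assms(2) by (auto simp: conj_class_def)
  have "g <# T #> inv g = (g \<otimes> h) <# S #> inv (g \<otimes> h)"
    unfolding h(2) using conj_conj[OF assms(3) h(1) part_subset[OF assms(1)]] .
  then show ?thesis using m_closed[OF assms(3) h(1)] unfolding conj_class_def by blast
qed

lemma conj_class_eq:
  assumes S: "S \<in> P" and T: "T \<in> conj_class S"
  shows "conj_class T = conj_class S"
proof -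
  obtain g where g: "g \<in> carrier G" "T = g <# S #> inv g" using T by (auto simp: conj_class_def)
  have "\<And>h. h \<in> carrier G \<Longrightarrow> h <# T #> inv h \<in> conj_class S"
    using conj_class_closed[OF S T] .
  moreover have "h <# S #> inv h \<in> conj_class T" if h: "h \<in> carrier G" for h
  proof -
    have "(h \<otimes> inv g) <# T #> inv (h \<otimes> inv g) = h <# S #> inv h"
      unfolding g(2) using conj_conj[of "h \<otimes> inv g" g S] h g part_subset[OF S]
      by (simp add: m_assoc)
    then show ?thesis using h g unfolding conj_class_def by (metis (mono_tags, lifting) inv_closed m_closed mem_Collect_eq)
  qed
  ultimately show ?thesis unfolding conj_class_def by auto
qed

lemma conj_class_parts: "S \<in> P \<Longrightarrow> conj_class S \<subseteq> P"
  using parts_conjugate by (auto simp: conj_class_def)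

lemma card_conj:
  assumes "g \<in> carrier G" "S \<subseteq> carrier G"
  shows "card (g <# S #> inv g) = card S"
proof -
  have "g <# S #> inv g = (\<lambda>s. g \<otimes> s \<otimes> inv g) ` S"
    unfolding l_coset_def r_coset_def by auto
  moreover have "inj_on (\<lambda>s. g \<otimes> s \<otimes> inv g) S"
    using assms by (auto simp: inj_on_def subset_iff)
  ultimately show ?thesis by (simp add: card_image)
qed

lemma conj_self:
  assumes "S \<in> P" "s \<in> S"
  shows "s <# S #> inv s = S"
  using assms part_subgroup part_carrier
  by (metis coset_join2 coset_join3 inv_closed subgroup.m_inv_closed)

text \<open>The class is an orbit whose stabilizer is the normalizer of S. The normalizer contains
  S, so the orbit-stabilizer theorem and Lagrange combine.\<close>

lemma conj_class_length:
  assumes S: "S \<in> P"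
  shows "card (conj_class S) * card S dvd order G"
proof -
  define \<phi> where "\<phi> = (\<lambda>g. \<lambda>H \<in> {H. subgroup H G}. g <# H #> inv g)"
  interpret act: group_action G "{H. subgroup H G}" \<phi>
    unfolding \<phi>_def by (rule action_by_conjugation_on_subgroups_set)
  have sS: "subgroup S G" using part_subgroup[OF S] .
  have orb: "orbit G \<phi> S = conj_class S"
    unfolding orbit_def conj_class_def \<phi>_def using sS by auto
  have sub: "S \<subseteq> stabilizer G \<phi> S"
    unfolding stabilizer_def \<phi>_def using sS conj_self[OF S] part_carrier[OF S] by auto
  have stab: "subgroup (stabilizer G \<phi> S) G" using act.stabilizer_subgroup sS by simp
  have "subgroup S (G\<lparr>carrier := stabilizer G \<phi> S\<rparr>)" using subgroup_incl[OF sS stab sub] .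
  then have "card S dvd card (stabilizer G \<phi> S)"
    using group.lagrange[OF subgroup_imp_group[OF stab]] unfolding order_def
    by (metis dvd_triv_right partial_object.select_convs(1) partial_object.update_convs(1) partial_object.surjective)
  then show ?thesis
    using act.orbit_stabilizer_theorem[of S] sS orb by (metis mem_Collect_eq mult_dvd_mono dvd_refl)
qed

definition parts_of_card :: "nat \<Rightarrow> 'a set set" where
  "parts_of_card k = {S \<in> P. card S = k}"

lemma conj_class_parts_of_card:
  "S \<in> parts_of_card k \<Longrightarrow> conj_class S \<subseteq> parts_of_card k"
  using conj_class_parts card_conj part_subset
  by (auto simp: parts_of_card_def conj_class_def)

text \<open>Members of equal cardinality split into disjoint conjugacy classes, so a p dividing
  every class length divides their number. For p = 0, which divides only 0, this merely provides a
  class.\<close>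

lemma ex_conj_class_not_dvd:
  assumes "\<not> p dvd card (parts_of_card k)"
  shows "\<exists>S \<in> parts_of_card k. \<not> p dvd card (conj_class S)"
proof (rule ccontr)
  assume "\<not> ?thesis"
  then have dvd: "p dvd card (conj_class S)" if "S \<in> parts_of_card k" for S using that by blast
  have fin: "finite (parts_of_card k)" using finite_parts by (simp add: parts_of_card_def)
  have inP: "S \<in> P" if "S \<in> parts_of_card k" for S using that by (simp add: parts_of_card_def)
  have "parts_of_card k = \<Union> (conj_class ` parts_of_card k)"
    using conj_class_parts_of_card conj_class_refl inP by blast
  moreover have "card (\<Union> (conj_class ` parts_of_card k)) = (\<Sum>C\<in>conj_class ` parts_of_card k. card C)"
  proof (rule card_Union_disjoint)
    show "pairwise disjnt (conj_class ` parts_of_card k)"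
    proof (rule pairwiseI)
      fix C D assume "C \<in> conj_class ` parts_of_card k" "D \<in> conj_class ` parts_of_card k" "C \<noteq> D"
      then obtain S T where "C = conj_class S" "D = conj_class T" "S \<in> P" "T \<in> P" using inP by blast
      then show "disjnt C D" using conj_class_eq \<open>C \<noteq> D\<close> unfolding disjnt_def by blast
    qed
    show "finite C" if "C \<in> conj_class ` parts_of_card k" for C
      using that conj_class_parts_of_card fin finite_subset by blast
  qed
  moreover have "p dvd (\<Sum>C\<in>conj_class ` parts_of_card k. card C)"
    using dvd by (intro dvd_sum) auto
  ultimately show False using assms by simp
qed

text \<open>The witness c is the length of the class of some S. If c = 1, every other member
  normalizes S. If c = 2, conjugation by elements of S fixes S and hence also the second member of
  the class. Both situations fall under \<open>normalizing_parts_card_dvd\<close>.\<close>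

lemma conj_class_rule:
  assumes "\<not> p dvd card (parts_of_card k)"
  obtains c where "0 < c" "c \<le> card (parts_of_card k)" "\<not> p dvd c" "c * k dvd order G"
    "\<And>l. c = 1 \<Longrightarrow> (if l = k then 1 else 0) < card (parts_of_card l) \<Longrightarrow> k * l dvd order G"
    "c = 2 \<Longrightarrow> k * k dvd order G"
proof -
  obtain S where S: "S \<in> parts_of_card k" "\<not> p dvd card (conj_class S)"
    using ex_conj_class_not_dvd[OF assms] by blast
  have SP: "S \<in> P" "card S = k" using S by (auto simp: parts_of_card_def)
  have fin: "finite (parts_of_card l)" for l using finite_parts by (simp add: parts_of_card_def)
  have finC: "finite (conj_class S)" using finite_subset[OF conj_class_parts_of_card[OF S(1)] fin] .
  show ?thesis
  proof
    show "0 < card (conj_class S)" using finC conj_class_refl[OF SP(1)] card_gt_0_iff by blast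
    show "card (conj_class S) \<le> card (parts_of_card k)"
      by (rule card_mono[OF fin conj_class_parts_of_card[OF S(1)]])
    show "\<not> p dvd card (conj_class S)" by (rule S(2))
    show "card (conj_class S) * k dvd order G" using conj_class_length[OF SP(1)] SP(2) by simp
  next
    fix l assume c1: "card (conj_class S) = 1"
      and l: "(if l = k then 1 else 0) < card (parts_of_card l)"
    \<comment> \<open>A member other than S is wanted, so for l = k the hypothesis on the count asks
      for at least two members.\<close>
    obtain T where T: "T \<in> parts_of_card l" "T \<noteq> S"
    proof -
      have "\<not> parts_of_card l \<subseteq> {S}"
      proof
        assume *: "parts_of_card l \<subseteq> {S}"
        then have "card (parts_of_card l) \<le> 1" using card_mono[OF _ *] by simp
        then have "l \<noteq> k" "parts_of_card l \<noteq> {}" using l by (auto split: if_splits)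
        then have "S \<in> parts_of_card l" using * by blast
        then show False using SP(2) \<open>l \<noteq> k\<close> by (simp add: parts_of_card_def)
      qed
      then show ?thesis using that by blast
    qed
    have TP: "T \<in> P" "card T = l" using T by (auto simp: parts_of_card_def)
    have C: "conj_class S = {S}"
      using c1 conj_class_refl[OF SP(1)] by (metis card_1_singletonE singletonD)
    have "t <# S #> inv t = S" if "t \<in> T" for t
      using conj_class_closed[OF SP(1) conj_class_refl[OF SP(1)] part_carrier[OF TP(1) that]] C by simp
    then have "card T * card S dvd order G" using normalizing_parts_card_dvd[OF TP(1) SP(1) T(2)] by blast
    then show "k * l dvd order G" using TP SP by (simp add: mult.commute)
  next
    assume c2: "card (conj_class S) = 2"
    then obtain T where T: "conj_class S = {S, T}" "T \<noteq> S"
      using conj_class_refl[OF SP(1)] by (metis card_2_iff doubleton_eq_iff insertE singletonD)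
    have "T \<in> parts_of_card k" using conj_class_parts_of_card[OF S(1)] T by blast
    then have TP: "T \<in> P" "card T = k" by (auto simp: parts_of_card_def)
    have "s <# T #> inv s = T" if s: "s \<in> S" for s
    proof -
      have sc: "s \<in> carrier G" using part_carrier[OF SP(1) s] .
      have "s <# T #> inv s \<in> {S, T}" using conj_class_closed[OF SP(1) _ sc, of T] T by simp
      moreover have "s <# T #> inv s \<noteq> s <# S #> inv s"
        using subgroup_conjugation_is_inj[OF sc part_subset[OF TP(1)] part_subset[OF SP(1)]] T(2) by blast
      ultimately show ?thesis using conj_self[OF SP(1) s] by simp
    qed
    then have "card S * card T dvd order G"
      using normalizing_parts_card_dvd[OF SP(1) TP(1)] T(2) by metis
    then show "k * k dvd order G" using TP SP by simp
  qed
qed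

end

section \<open>Counting the members of a partition\<close>

text \<open>A list of pairs \<open>(k, m)\<close> records that a partition has \<open>m\<close> members of cardinality \<open>k\<close>.
  The definitions below collect the divisibility conditions of \<open>conj_class_rule\<close> on such a list in
  executable form; for \<open>p = 0\<close> they say that some conjugacy class exists at all. Integers are
  used since their binary arithmetic is fast in the simplifier.\<close>

definition class_length_ok :: "int \<Rightarrow> (int \<times> int) list \<Rightarrow> int \<Rightarrow> int \<Rightarrow> int \<Rightarrow> int \<Rightarrow> bool" where
  "class_length_ok N xs k m p c \<longleftrightarrow> c \<le> m \<and> \<not> p dvd c \<and> c * k dvd N \<and>
     (if c = 1 then list_all (\<lambda>(l, n). (if l = k then 1 else 0) < n \<longrightarrow> k * l dvd N) xs
      else if c = 2 then k * k dvd N else True)"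

definition class_lengths_ok :: "int \<Rightarrow> (int \<times> int) list \<Rightarrow> int \<Rightarrow> int \<Rightarrow> int \<Rightarrow> bool" where
  "class_lengths_ok N xs k m p \<longleftrightarrow>
     p dvd m \<or> list_ex (class_length_ok N xs k m p) [1, 2, 3, 4, 5, 6, 7, 8]"

fun counted_order :: "(int \<times> int) list \<Rightarrow> int" where
  "counted_order [] = 1"
| "counted_order ((k, m) # xs) = (k - 1) * m + counted_order xs"

fun counts_ok :: "int \<Rightarrow> (int \<times> int) list \<Rightarrow> (int \<times> int) list \<Rightarrow> bool" where
  "counts_ok N xs [] = True"
| "counts_ok N xs ((k, m) # ys) =
     (if class_lengths_ok N xs k m 0
      then if class_lengths_ok N xs k m 2
        then if class_lengths_ok N xs k m 3 then counts_ok N xs ys else False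
        else False
      else False)"

definition admissible :: "(int \<times> int) list \<Rightarrow> bool" where
  "admissible xs \<longleftrightarrow> counts_ok (counted_order xs) xs xs"

text \<open>Distributes \<open>s\<close> further members over the cardinalities \<open>k # ks\<close>, where \<open>c\<close> members of
  cardinality \<open>k\<close> and the counts \<open>xs\<close> have already been chosen.\<close>

fun none_admissible :: "(int \<times> int) list \<Rightarrow> int \<Rightarrow> int \<Rightarrow> int list \<Rightarrow> nat \<Rightarrow> bool" where
  "none_admissible xs k c [] s = (\<not> admissible ((k, c + int s) # xs))"
| "none_admissible xs k c (k' # ks) 0 = none_admissible ((k, c) # xs) k' 0 ks 0"
| "none_admissible xs k c (k' # ks) (Suc s) =
     (none_admissible xs k (c + 1) (k' # ks) s \<and> none_admissible ((k, c) # xs) k' 0 ks (Suc s))"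

text \<open>Every count function m with the right total is a leaf of the search: the branch that
  raises c is followed until c reaches \<open>m k\<close>, and then the search passes to the next
  cardinality. The list is reversed because finished counts are consed onto
  \<open>xs\<close>.\<close>

lemma none_admissibleD:
  assumes "none_admissible xs k c ks s" and "\<And>k. 0 \<le> m k" and "c \<le> m k"
    and "m k - c + (\<Sum>k\<leftarrow>ks. m k) = int s"
  shows "\<not> admissible (rev (map (\<lambda>k. (k, m k)) (k # ks)) @ xs)"
  using assms
proof (induction xs k c ks s rule: none_admissible.induct)
  case (1 xs k c s)
  then have "m k = c + int s" by simp
  then show ?case using 1 by simp
next
  case (2 xs k c k' ks)
  have "0 \<le> (\<Sum>k\<leftarrow>ks. m k)" using 2 by (intro sum_list_nonneg) auto
  then have "m k = c" "m k' + (\<Sum>k\<leftarrow>ks. m k) = 0"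
    using 2(4,5) 2(3)[of k'] by auto
  then show ?case using 2 by simp
next
  case (3 xs k c k' ks s)
  show ?case
  proof (cases "m k = c")
    case True
    then show ?thesis using 3 by simp
  next
    case False
    then show ?thesis using 3 by simp
  qed
qed

text \<open>For t = 4, 5, 6 the lists run through the cardinalities from 2 to t - 2. The analogous
  claim for t = 7 is false: seven members of cardinality 2 in a group of order 8 are
  admissible.\<close>

lemma none_admissible_small:
  "none_admissible [] 2 0 [] 4" "none_admissible [] 2 0 [3] 5" "none_admissible [] 2 0 [3, 4] 6"
  by code_simp+

text \<open>Distributing eight members over five cardinalities gives 495 lists to refute.\<close>

lemma none_admissible_8: "none_admissible [] 2 0 [3, 4, 5, 6] 8"
  by code_simp

lemma counts_ok_iff:
  "counts_ok N xs ys \<longleftrightarrow> (\<forall>(k, m) \<in> set ys. \<forall>p \<in> {0, 2, 3}. class_lengths_ok N xs k m p)"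
  by (induction N xs ys rule: counts_ok.induct) auto

context group_partition
begin

section \<open>From actual partitions to lists of counts\<close>

lemma sum_parts_by_card:
  fixes f :: "nat \<Rightarrow> nat"
  assumes "distinct L" "\<And>S. S \<in> P \<Longrightarrow> card S \<in> set L"
  shows "(\<Sum>S\<in>P. f (card S)) = (\<Sum>k\<leftarrow>L. f k * card (parts_of_card k))"
proof -
  have "(\<Sum>S\<in>P. f (card S)) = (\<Sum>k\<in>set L. \<Sum>S\<in>{S \<in> P. card S = k}. f (card S))"
    by (rule sum.group[symmetric]) (use assms finite_parts in auto)
  also have "\<dots> = (\<Sum>k\<in>set L. f k * card (parts_of_card k))"
    by (intro sum.cong) (auto simp: parts_of_card_def)
  finally show ?thesis using assms(1) by (simp add: sum_list_distinct_conv_sum_set)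
qed

definition counts :: "nat list \<Rightarrow> (int \<times> int) list" where
  "counts L = map (\<lambda>k. (int k, int (card (parts_of_card k)))) L"

lemma counted_order_counts:
  assumes "\<And>k. k \<in> set L \<Longrightarrow> 1 \<le> k"
  shows "counted_order (counts L) = 1 + int (\<Sum>k\<leftarrow>L. (k - 1) * card (parts_of_card k))"
  using assms by (induction L) (auto simp: counts_def of_nat_diff)

text \<open>This is the soundness of the executable test: where p does not divide a count,
  \<open>conj_class_rule\<close> supplies the class length that the test looks for.\<close>

lemma admissible_counts:
  assumes L: "distinct L" "\<And>S. S \<in> P \<Longrightarrow> card S \<in> set L" "\<And>k. k \<in> set L \<Longrightarrow> 1 \<le> k"
    and P8: "card P \<le> 8"
  shows "admissible (counts L)"
proof -
  have N: "counted_order (counts L) = int (order G)"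
    using counted_order_counts[OF L(3)] order_eq_sum sum_parts_by_card[OF L(1,2), of "\<lambda>k. k - 1"] by simp
  have "class_lengths_ok (int (order G)) (counts L) (int k) (int (card (parts_of_card k))) (int p)" for k p
  proof (cases "p dvd card (parts_of_card k)")
    case True
    then show ?thesis by (simp add: class_lengths_ok_def)
  next
    case False
    from conj_class_rule[OF False] obtain c where
      c: "0 < c" "c \<le> card (parts_of_card k)" "\<not> p dvd c" "c * k dvd order G"
      "\<And>l. c = 1 \<Longrightarrow> (if l = k then 1 else 0) < card (parts_of_card l) \<Longrightarrow> k * l dvd order G"
      "c = 2 \<Longrightarrow> k * k dvd order G" by metis
    have "card (parts_of_card k) \<le> card P"
      using finite_parts by (intro card_mono) (auto simp: parts_of_card_def)
    \<comment> \<open>A class has no more members than the whole partition, so the list up to 8 in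
      \<open>class_lengths_ok\<close> contains its length.\<close>
    then have "c \<in> {1, 2, 3, 4, 5, 6, 7, 8}" using c(1,2) P8 by auto
    then have mem: "int c \<in> set [1, 2, 3, 4, 5, 6, 7, 8]" by auto
    have "class_length_ok (int (order G)) (counts L) (int k) (int (card (parts_of_card k))) (int p) (int c)"
      using c(2-4,6) c(5)
      by (auto simp: class_length_ok_def counts_def list_all_iff simp flip: of_nat_mult split: if_splits)
    then show ?thesis unfolding class_lengths_ok_def list_ex_iff using mem by blast
  qed
  from this[of _ 0] this[of _ 2] this[of _ 3] show ?thesis
    unfolding admissible_def N counts_ok_iff by (auto simp: counts_def)
qed

lemma no_admissible_counts:
  assumes na: "none_admissible [] (int k) 0 (map int ks) (card P)"
    and L: "distinct (k # ks)" "\<And>S. S \<in> P \<Longrightarrow> card S \<in> set (k # ks)"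
      "0 \<notin> set (k # ks)" and P8: "card P \<le> 8"
  shows False
proof -
  define m where "m = (\<lambda>j::int. int (card (parts_of_card (nat j))))"
  have "card P = (\<Sum>j\<leftarrow>k # ks. card (parts_of_card j))"
    using sum_parts_by_card[OF L(1,2), of "\<lambda>_. 1"] by simp
  then have "m (int k) - 0 + (\<Sum>j\<leftarrow>map int ks. m j) = int (card P)"
    by (simp add: m_def o_def) (simp add: o_def flip: sum_list_of_nat)
  from none_admissibleD[OF na _ _ this] have "\<not> admissible (rev (map (\<lambda>j. (j, m j)) (int k # map int ks)))"
    by (simp add: m_def)
  moreover have "rev (map (\<lambda>j. (j, m j)) (int k # map int ks)) = counts (rev (k # ks))"
    by (simp add: counts_def m_def rev_map)
  moreover have "1 \<le> j" if "j \<in> set (k # ks)" for j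
    using that L(3) by (metis less_one not_le)
  ultimately show False using admissible_counts[of "rev (k # ks)"] L(1,2) P8 by auto
qed

lemma ex_large_part:
  assumes P: "card P \<in> {3, 4, 5, 6, 8}"
  shows "\<exists>S\<in>P. card S = card P - 1"
proof (rule ccontr)
  assume none: "\<not> ?thesis"
  \<comment> \<open>With the extremal value t - 1 ruled out, only the cardinalities from 2 to t - 2
    remain.\<close>
  have range: "2 \<le> card S \<and> card S < card P - 1" if S: "S \<in> P" for S
  proof -
    have "\<one> \<in> S" "S \<noteq> {\<one>}" using subgroup.one_closed[OF part_subgroup[OF S]] part_nontrivial[OF S] .
    then have "card S \<noteq> 0" "card S \<noteq> 1"
      using part_finite_card_le(1)[OF S] by (auto simp: card_1_singleton_iff)
    moreover have "card S \<le> card P - 1" "card S \<noteq> card P - 1"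
      using part_finite_card_le(2)[OF S] none S by auto
    ultimately show ?thesis by linarith
  qed
  \<comment> \<open>For t = 3 this range is already empty, which is why the search is needed only
    from t = 4 on.\<close>
  have "P \<noteq> {}" using P by auto
  then obtain S where "S \<in> P" by blast
  then have "card P \<noteq> 3" using range[of S] by auto
  then consider "card P = 4" | "card P = 5" | "card P = 6" | "card P = 8" using P by auto
  then show False
  proof cases
    case 1
    have "card S \<in> set [2]" if "S \<in> P" for S using range[OF that] 1 by auto
    with no_admissible_counts[of 2 "[]"] 1 show False using none_admissible_small by simp
  next
    case 2
    have "card S \<in> set [2, 3]" if "S \<in> P" for S using range[OF that] 2 by auto
    with no_admissible_counts[of 2 "[3]"] 2 show False using none_admissible_small by simp
  next
    case 3
    have "card S \<in> set [2, 3, 4]" if "S \<in> P" for S using range[OF that] 3 by auto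
    with no_admissible_counts[of 2 "[3, 4]"] 3 show False using none_admissible_small by simp
  next
    case 4
    have "card S \<in> set [2, 3, 4, 5, 6]" if "S \<in> P" for S using range[OF that] 4 by auto
    with no_admissible_counts[of 2 "[3, 4, 5, 6]"] 4 show False using none_admissible_8 by simp
  qed
qed

end

section \<open>Groups with abelian centralizers\<close>

definition center :: "('a, 'b) monoid_scheme \<Rightarrow> 'a set" where
  "center G = {z \<in> carrier G. centralizer G z = carrier G}"

text \<open>Both images are A modulo the same equivalence relation. A bijection is stated in place
  of an equality of cardinalities because finiteness is transferred along it as well.\<close>

lemma card_image_eqI:
  assumes "\<And>x y. x \<in> A \<Longrightarrow> y \<in> A \<Longrightarrow> f x = f y \<longleftrightarrow> h x = h y"
  shows "bij_betw (\<lambda>w. f (inv_into A h w)) (h ` A) (f ` A)"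
proof -
  have *: "f (inv_into A h (h x)) = f x" if "x \<in> A" for x
    using that assms by (metis f_inv_into_f imageI inv_into_into)
  show ?thesis
    unfolding bij_betw_def
  proof
    show "inj_on (\<lambda>w. f (inv_into A h w)) (h ` A)"
      using * assms by (auto simp: inj_on_def)
    show "(\<lambda>w. f (inv_into A h w)) ` h ` A = f ` A"
      using * by (auto simp: image_iff)
  qed
qed

locale abelian_centralizers = group G for G (structure) +
  assumes finite_Cent: "finite (Cent G)"
    and centralizer_comm: "x \<in> carrier G \<Longrightarrow> x \<notin> center G \<Longrightarrow> a \<in> centralizer G x \<Longrightarrow>
      b \<in> centralizer G x \<Longrightarrow> a \<in> centralizer G b"
    and noncentral: "center G \<noteq> carrier G"
begin

abbreviation "Z \<equiv> center G"

lemma center_iff: "z \<in> Z \<longleftrightarrow> z \<in> carrier G \<and> (\<forall>x \<in> carrier G. x \<otimes> z = z \<otimes> x)"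
  by (auto simp: center_def centralizer_def)

lemma center_subset_centralizer: "x \<in> carrier G \<Longrightarrow> Z \<subseteq> centralizer G x"
  by (auto simp: center_iff centralizer_iff)

lemma center_normal: "Z \<lhd> G"
proof (rule normal_invI)
  have cent: "z \<in> Z \<longleftrightarrow> z \<in> carrier G \<and> (\<forall>x \<in> carrier G. z \<in> centralizer G x)" for z
    by (auto simp: center_iff centralizer_iff)
  show "subgroup Z G"
  proof (rule subgroupI)
    show "Z \<subseteq> carrier G" by (auto simp: center_iff)
    show "Z \<noteq> {}" using centralizer_one by (auto simp: center_def)
    show "inv z \<in> Z" if "z \<in> Z" for z
      using that subgroup.m_inv_closed[OF centralizer_subgroup] by (simp add: cent)
    show "z \<otimes> w \<in> Z" if "z \<in> Z" "w \<in> Z" for z w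
      using that subgroup.m_closed[OF centralizer_subgroup] by (simp add: cent)
  qed
  show "g \<otimes> z \<otimes> inv g \<in> Z" if "g \<in> carrier G" "z \<in> Z" for g z
  proof -
    have "g \<otimes> z \<otimes> inv g = z" using that by (simp add: center_iff m_assoc)
    then show ?thesis using that by simp
  qed
qed

sublocale Z: normal Z G by (rule center_normal)

text \<open>Each of x and y lies in the centralizer of the other, and both centralizers are abelian,
  so each is contained in the other.\<close>

lemma maximal_centralizer:
  assumes x: "x \<in> carrier G" "x \<notin> Z" and y: "y \<in> centralizer G x" "y \<notin> Z"
  shows "centralizer G y = centralizer G x"
proof -
  have yc: "y \<in> carrier G" using y centralizer_subset by blast
  have "x \<in> centralizer G y" using centralizer_sym x y by blast
  then show ?thesis using centralizer_comm[OF x] centralizer_comm[OF yc y(2)] y(1) by blast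
qed

text \<open>These are the preimages in G of the members of the partition of G/Z.\<close>

definition cparts :: "'a set set" where
  "cparts = Cent G - {carrier G}"

lemma cparts_iff: "A \<in> cparts \<longleftrightarrow> (\<exists>x \<in> carrier G - Z. A = centralizer G x)"
proof -
  have "x \<in> Z \<longleftrightarrow> centralizer G x = carrier G" if "x \<in> carrier G" for x
    unfolding center_def using that by blast
  then have "(\<exists>x \<in> carrier G - Z. A = centralizer G x) \<longleftrightarrow>
      (\<exists>x \<in> carrier G. A = centralizer G x \<and> centralizer G x \<noteq> carrier G)"
    by (metis Diff_iff)
  also have "\<dots> \<longleftrightarrow> A \<in> cparts" unfolding cparts_def Cent_def by auto
  finally show ?thesis ..
qed

lemma cpart_subgroup: "A \<in> cparts \<Longrightarrow> subgroup A G"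
  using centralizer_subgroup by (auto simp: cparts_iff)

lemma center_subset_cpart: "A \<in> cparts \<Longrightarrow> Z \<subseteq> A"
  using center_subset_centralizer by (auto simp: cparts_iff)

lemma cpart_eq: "A \<in> cparts \<Longrightarrow> x \<in> A \<Longrightarrow> x \<notin> Z \<Longrightarrow> A = centralizer G x"
  using maximal_centralizer by (auto simp: cparts_iff)

lemma cpart_of: "x \<in> carrier G \<Longrightarrow> x \<notin> Z \<Longrightarrow> centralizer G x \<in> cparts"
  by (auto simp: cparts_iff)

lemma cpart_carrier: "A \<in> cparts \<Longrightarrow> x \<in> A \<Longrightarrow> x \<in> carrier G"
  using cpart_subgroup subgroup.mem_carrier by fast

lemma cpart_comm: "A \<in> cparts \<Longrightarrow> x \<in> A \<Longrightarrow> y \<in> A \<Longrightarrow> x \<otimes> y = y \<otimes> x"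
  using centralizer_comm by (fastforce simp: cparts_iff centralizer_iff)

lemma cparts_Int:
  assumes "A \<in> cparts" "B \<in> cparts" "A \<noteq> B"
  shows "A \<inter> B = Z"
proof -
  have "x \<in> Z" if "x \<in> A" "x \<in> B" for x using that assms cpart_eq by metis
  then show ?thesis using center_subset_cpart assms by blast
qed

lemma centralizer_conj:
  assumes "g \<in> carrier G" "x \<in> carrier G" "y \<in> carrier G"
  shows "g \<otimes> y \<otimes> inv g \<in> centralizer G (g \<otimes> x \<otimes> inv g) \<longleftrightarrow> y \<in> centralizer G x"
proof -
  have *: "(g \<otimes> a \<otimes> inv g) \<otimes> (g \<otimes> b \<otimes> inv g) = g \<otimes> (a \<otimes> b) \<otimes> inv g"
    if "a \<in> carrier G" "b \<in> carrier G" for a b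
    using that assms by (simp add: m_assoc inv_mult_cancel)
  show ?thesis using assms by (simp add: centralizer_iff * )
qed

lemma cpart_conj:
  assumes A: "A \<in> cparts" and g: "g \<in> carrier G"
  shows "(\<lambda>a. g \<otimes> a \<otimes> inv g) ` A \<in> cparts"
proof -
  obtain x where x: "x \<in> carrier G" "x \<notin> Z" "A = centralizer G x" using A cparts_iff by auto
  have *: "g \<otimes> (inv g \<otimes> y \<otimes> g) \<otimes> inv g = y" if "y \<in> carrier G" for y
    using that g by (simp add: m_assoc inv_mult_cancel)
  have "(\<lambda>a. g \<otimes> a \<otimes> inv g) ` A = centralizer G (g \<otimes> x \<otimes> inv g)"
  proof (intro equalityI subsetI)
    fix y assume "y \<in> (\<lambda>a. g \<otimes> a \<otimes> inv g) ` A"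
    then show "y \<in> centralizer G (g \<otimes> x \<otimes> inv g)"
      using centralizer_conj[OF g x(1)] cpart_carrier[OF A] x(3) by blast
  next
    fix y assume y: "y \<in> centralizer G (g \<otimes> x \<otimes> inv g)"
    then have yc: "y \<in> carrier G" using centralizer_subset by blast
    then have "inv g \<otimes> y \<otimes> g \<in> A"
      using centralizer_conj[OF g x(1), of "inv g \<otimes> y \<otimes> g"] y g *[OF yc] x(3) by simp
    then show "y \<in> (\<lambda>a. g \<otimes> a \<otimes> inv g) ` A" using *[OF yc] by (metis imageI)
  qed
  moreover have "g \<otimes> x \<otimes> inv g \<notin> Z"
  proof
    assume "g \<otimes> x \<otimes> inv g \<in> Z"
    then have "inv g \<otimes> (g \<otimes> x \<otimes> inv g) \<otimes> g \<in> Z" using Z.inv_op_closed1[OF g] by blast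
    then show False using x g by (simp add: m_assoc inv_mult_cancel)
  qed
  ultimately show ?thesis using cpart_of g x by simp
qed

section \<open>The partition of the quotient by the center\<close>

definition \<pi> :: "'a \<Rightarrow> 'a set" where "\<pi> g = Z #> g"

lemma \<pi>_hom: "group_hom G (G Mod Z) \<pi>"
  using Z.r_coset_hom_Mod Z.factorgroup_is_group is_group
  by (auto simp: group_hom_def group_hom_axioms_def \<pi>_def[abs_def])

lemma \<pi>_eq_iff:
  assumes "x \<in> carrier G" "y \<in> carrier G"
  shows "\<pi> x = \<pi> y \<longleftrightarrow> x \<otimes> inv y \<in> Z"
proof
  assume "\<pi> x = \<pi> y"
  then show "x \<otimes> inv y \<in> Z"
    using Z.rcos_module_imp[OF is_group] rcos_self[OF assms(1) Z.subgroup_axioms] assms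
    unfolding \<pi>_def by blast
next
  assume "x \<otimes> inv y \<in> Z"
  then have "x \<in> Z #> y" using Z.rcos_module_rev[OF is_group assms(2,1)] by blast
  then show "\<pi> x = \<pi> y" using repr_independence[OF _ assms(2) Z.subgroup_axioms] unfolding \<pi>_def by simp
qed

text \<open>A subgroup containing Z is a union of cosets of Z, so membership can be tested modulo
  Z.\<close>

lemma \<pi>_mem_iff:
  assumes A: "subgroup A G" "Z \<subseteq> A" and x: "x \<in> carrier G"
  shows "\<pi> x \<in> \<pi> ` A \<longleftrightarrow> x \<in> A"
proof
  assume "\<pi> x \<in> \<pi> ` A"
  then obtain a where a: "a \<in> A" "\<pi> x = \<pi> a" by blast
  then have "x \<otimes> inv a \<in> A" using \<pi>_eq_iff[OF x subgroup.mem_carrier[OF A(1) a(1)]] A(2) by blast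
  then show "x \<in> A"
    using subgroup_mult_cancel_right[OF A(1) x subgroup.m_inv_closed[OF A(1) a(1)]] by blast
qed simp

lemma carrier_quotient: "carrier (G Mod Z) = \<pi> ` carrier G"
  by (simp add: carrier_FactGroup \<pi>_def[abs_def])

lemma \<pi>_image_inj: "inj_on (\<lambda>A. \<pi> ` A) cparts"
proof (rule inj_onI)
  fix A B assume "A \<in> cparts" "B \<in> cparts" "\<pi> ` A = \<pi> ` B"
  then show "A = B"
    using \<pi>_mem_iff cpart_subgroup center_subset_cpart cpart_carrier by (metis subset_antisym subsetI)
qed

lemma quotient_partition: "group_partition (G Mod Z) ((\<lambda>A. \<pi> ` A) ` cparts)"
proof -
  interpret h: group_hom G "G Mod Z" \<pi> by (rule \<pi>_hom)
  note mem = \<pi>_mem_iff[OF cpart_subgroup center_subset_cpart]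
  have one: "\<pi> \<one> = \<one>\<^bsub>G Mod Z\<^esub>" by (rule h.hom_one)
  have center_\<pi>: "\<pi> x = \<one>\<^bsub>G Mod Z\<^esub> \<longleftrightarrow> x \<in> Z" if "x \<in> carrier G" for x
    using that \<pi>_eq_iff[of x \<one>] one by simp
  show ?thesis
  proof (intro group_partition.intro group_partition_axioms.intro Z.factorgroup_is_group)
    show "finite ((\<lambda>A. \<pi> ` A) ` cparts)" using finite_Cent by (simp add: cparts_def)
    show "subgroup S (G Mod Z)" if "S \<in> (\<lambda>A. \<pi> ` A) ` cparts" for S
      using that h.subgroup_img_is_subgroup cpart_subgroup by blast
    show "S \<noteq> {\<one>\<^bsub>G Mod Z\<^esub>}" if "S \<in> (\<lambda>A. \<pi> ` A) ` cparts" for S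
    proof -
      obtain A where A: "A \<in> cparts" "S = \<pi> ` A" using \<open>S \<in> _\<close> by blast
      then obtain x where x: "x \<in> carrier G" "x \<notin> Z" "A = centralizer G x" using cparts_iff by auto
      then have "\<pi> x \<in> S" "\<pi> x \<noteq> \<one>\<^bsub>G Mod Z\<^esub>"
        using self_in_centralizer A center_\<pi> by auto
      then show ?thesis by blast
    qed
    show "S \<noteq> carrier (G Mod Z)" if "S \<in> (\<lambda>A. \<pi> ` A) ` cparts" for S
    proof
      obtain A where A: "A \<in> cparts" "S = \<pi> ` A" using \<open>S \<in> _\<close> by blast
      assume "S = carrier (G Mod Z)"
      then have "\<pi> x \<in> \<pi> ` A" if "x \<in> carrier G" for x
        unfolding A(2) carrier_quotient using that by blast
      then have "carrier G \<subseteq> A" using mem[OF A(1) A(1)] by blast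
      then have "A = carrier G" using cpart_carrier[OF A(1)] by blast
      then show False using A(1) by (simp add: cparts_def)
    qed
    show "\<Union> ((\<lambda>A. \<pi> ` A) ` cparts) = carrier (G Mod Z)"
    proof -
      have "x \<in> \<Union>cparts" if x: "x \<in> carrier G" for x
      proof (cases "x \<in> Z")
        case True
        \<comment> \<open>Every member contains the center, but some member must exist for the
          center to be covered.\<close>
        obtain y where "y \<in> carrier G" "y \<notin> Z" using noncentral Z.subset by blast
        then show ?thesis using True center_subset_cpart cpart_of by blast
      next
        case False
        then show ?thesis using cpart_of[OF x] self_in_centralizer[OF x] by blast
      qed
      then have "\<Union>cparts = carrier G" using cpart_carrier by blast
      then show ?thesis unfolding carrier_quotient by blast
    qed
    show "S \<inter> T = {\<one>\<^bsub>G Mod Z\<^esub>}"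
      if "S \<in> (\<lambda>A. \<pi> ` A) ` cparts" "T \<in> (\<lambda>A. \<pi> ` A) ` cparts" "S \<noteq> T" for S T
    proof -
      obtain A B where AB: "A \<in> cparts" "S = \<pi> ` A" "B \<in> cparts" "T = \<pi> ` B"
        using \<open>S \<in> _\<close> \<open>T \<in> _\<close> by blast
      then have "A \<inter> B = Z" using cparts_Int \<open>S \<noteq> T\<close> by blast
      have "\<pi> x = \<one>\<^bsub>G Mod Z\<^esub>" if "x \<in> A" "\<pi> x \<in> T" for x
      proof -
        have "x \<in> B" using mem[OF AB(3) AB(3)] that cpart_carrier[OF AB(1)] AB(4) by blast
        then show ?thesis using \<open>A \<inter> B = Z\<close> that center_\<pi> cpart_carrier[OF AB(1)] by blast
      qed
      moreover have "\<one>\<^bsub>G Mod Z\<^esub> \<in> S" "\<one>\<^bsub>G Mod Z\<^esub> \<in> T"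
        using AB one subgroup.one_closed[OF cpart_subgroup] by (metis imageI)+
      ultimately show ?thesis using AB(2) by blast
    qed
    show "q <#\<^bsub>G Mod Z\<^esub> S #>\<^bsub>G Mod Z\<^esub> inv\<^bsub>G Mod Z\<^esub> q \<in> (\<lambda>A. \<pi> ` A) ` cparts"
      if "q \<in> carrier (G Mod Z)" "S \<in> (\<lambda>A. \<pi> ` A) ` cparts" for q S
    proof -
      obtain A where A: "A \<in> cparts" "S = \<pi> ` A" using \<open>S \<in> _\<close> by blast
      obtain g where g: "g \<in> carrier G" "q = \<pi> g" using \<open>q \<in> _\<close> carrier_quotient by blast
      have "\<pi> (g \<otimes> a \<otimes> inv g) = q \<otimes>\<^bsub>G Mod Z\<^esub> \<pi> a \<otimes>\<^bsub>G Mod Z\<^esub> inv\<^bsub>G Mod Z\<^esub> q" if "a \<in> A" for a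
        using that cpart_carrier[OF A(1)] g by (simp del: mult_FactGroup)
      then have "q <#\<^bsub>G Mod Z\<^esub> S #>\<^bsub>G Mod Z\<^esub> inv\<^bsub>G Mod Z\<^esub> q = \<pi> ` (\<lambda>a. g \<otimes> a \<otimes> inv g) ` A"
        unfolding l_coset_def r_coset_def A(2) by (auto simp: image_iff)
      then show ?thesis using cpart_conj[OF A(1) g(1)] by blast
    qed
  qed
qed

text \<open>The one centralizer that is not counted is \<open>carrier G\<close>, that of the
  identity.\<close>

lemma card_quotient_parts: "card ((\<lambda>A. \<pi> ` A) ` cparts) = card (Cent G) - 1"
proof -
  have "carrier G \<in> Cent G" using centralizer_in_Cent[OF one_closed] by (simp add: centralizer_one)
  then show ?thesis using finite_Cent \<pi>_image_inj by (simp add: card_image cparts_def)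
qed

text \<open>Since \<open>|A/Z|\<close> is as large as possible, every coset \<open>A g\<close> other than \<open>A\<close> meets all the other
  members \<open>T\<close>. Applied to \<open>T = gAg\<^sup>-\<^sup>1\<close> this gives normality. If \<open>a y\<close> and \<open>a' y'\<close> lie in the same
  \<open>T\<close>, they commute, so that \<open>K y a' = K y' a\<close> for the commutators \<open>K y a\<close> below; hence the
  image of \<open>K y\<close> on \<open>A\<close> does not depend on \<open>y\<close>.\<close>

lemma derived_of_large_part:
  assumes A: "A \<in> cparts" and card: "card (\<pi> ` A) = card (Cent G) - 2"
  shows "finite (derived G (carrier G)) \<and> card (derived G (carrier G)) = card (Cent G) - 2"
proof -
  interpret h: group_hom G "G Mod Z" \<pi> by (rule \<pi>_hom)
  interpret Q: group_partition "G Mod Z" "(\<lambda>A. \<pi> ` A) ` cparts" by (rule quotient_partition)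
  have sA: "subgroup A G" using cpart_subgroup[OF A] .
  have Ac: "a \<in> carrier G" if "a \<in> A" for a using cpart_carrier[OF A that] .
  have Acomm: "a \<otimes> a' = a' \<otimes> a" if "a \<in> A" "a' \<in> A" for a a' using cpart_comm[OF A that] .
  have Ainv: "inv a \<in> A" if "a \<in> A" for a using subgroup.m_inv_closed[OF sA that] .
  have Amult: "a \<otimes> a' \<in> A" if "a \<in> A" "a' \<in> A" for a a' using subgroup.m_closed[OF sA that] .
  have Acan: "g \<in> A" if "a \<in> A" "a \<otimes> g \<in> A" "g \<in> carrier G" for a g
    using subgroup_mult_cancel_left[OF sA that(3,1,2)] .
  \<comment> \<open>The statement about G/Z lifts to G because T contains Z, so that a point lies in
    T as soon as its coset lies in the image of T.\<close>
  have meet: "\<exists>a\<in>A. a \<otimes> g \<in> T" if T: "T \<in> cparts" "T \<noteq> A" and g: "g \<in> carrier G" "g \<notin> A" for T g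
  proof -
    have ne: "\<pi> ` T \<noteq> \<pi> ` A" using inj_onD[OF \<pi>_image_inj _ T(1) A] T(2) by blast
    have gQ: "\<pi> g \<in> carrier (G Mod Z)" using g carrier_quotient by blast
    have gA: "\<pi> g \<notin> \<pi> ` A" using \<pi>_mem_iff[OF sA center_subset_cpart[OF A] g(1)] g(2) by simp
    have "card (\<pi> ` A) = card ((\<lambda>A. \<pi> ` A) ` cparts) - 1"
      unfolding card_quotient_parts card by simp
    from Q.part_coset_meets_all[OF imageI[OF A] this imageI[OF T(1)] ne gQ gA]
    obtain s where s: "s \<in> \<pi> ` A" "s \<otimes>\<^bsub>G Mod Z\<^esub> \<pi> g \<in> \<pi> ` T" by blast
    then obtain a where a: "a \<in> A" "s = \<pi> a" by blast
    have "\<pi> (a \<otimes> g) \<in> \<pi> ` T"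
      using h.hom_mult[OF Ac[OF a(1)] g(1)] s(2) a(2) by (simp only:)
    then have "a \<otimes> g \<in> T"
      using \<pi>_mem_iff[OF cpart_subgroup[OF T(1)] center_subset_cpart[OF T(1)]
          m_closed[OF Ac[OF a(1)] g(1)]] by blast
    then show ?thesis using a by blast
  qed
  have conjA: "g \<otimes> a \<otimes> inv g \<in> A" if g: "g \<in> carrier G" and a: "a \<in> A" for g a
  proof (cases "g \<in> A")
    case True
    then show ?thesis using a Amult Ainv by simp
  next
    case False
    define T where "T = (\<lambda>a. g \<otimes> a \<otimes> inv g) ` A"
    have "T = A"
    proof (rule ccontr)
      assume "T \<noteq> A"
      \<comment> \<open>The coset of \<open>inv g\<close> is the useful one: an equation
        \<open>b \<otimes> inv g = g \<otimes> a' \<otimes> inv g\<close> loses its right factor and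
        exhibits g as an element of A.\<close>
      have "inv g \<notin> A" using subgroup_inv_cancel[OF sA g] False by blast
      then obtain b where b: "b \<in> A" "b \<otimes> inv g \<in> T"
        using meet[OF cpart_conj[OF A g, folded T_def] \<open>T \<noteq> A\<close> inv_closed[OF g]] by blast
      then obtain a' where a': "a' \<in> A" "b \<otimes> inv g = g \<otimes> a' \<otimes> inv g" unfolding T_def by blast
      then have "b = g \<otimes> a'"
        using r_cancel[of b "inv g" "g \<otimes> a'"] b(1) g Ac by simp
      then have "g \<in> A" using subgroup_mult_cancel_right[OF sA g a'(1)] b by simp
      then show False using False by blast
    qed
    then show ?thesis using a unfolding T_def by blast
  qed
  have "A \<noteq> carrier G" using A by (simp add: cparts_def)
  then obtain b where b: "b \<in> carrier G" "b \<notin> A" using Ac by blast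
  have notZ: "g \<notin> Z" if "g \<notin> A" for g using that center_subset_cpart[OF A] by blast
  define B where "B = centralizer G b"
  have B: "B \<in> cparts" unfolding B_def using cpart_of b notZ by blast
  have bB: "b \<in> B" unfolding B_def using self_in_centralizer b by blast
  have Bc: "y \<in> carrier G" if "y \<in> B" for y using cpart_carrier[OF B that] .
  have Bcomm: "y \<otimes> y' = y' \<otimes> y" if "y \<in> B" "y' \<in> B" for y y' using cpart_comm[OF B that] .
  have BA: "B \<noteq> A" using b bB by blast
  \<comment> \<open>This is the commutator of \<open>inv a\<close> and y, bracketed as a product of
    two elements of A, which commute with everything in A.\<close>
  define K where "K = (\<lambda>y a. inv a \<otimes> (y \<otimes> a \<otimes> inv y))"
  have KA: "K y a \<in> A" if "y \<in> carrier G" "a \<in> A" for y a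
    unfolding K_def using that Ainv Amult conjA by simp
  have K_sub: "K y' ` A \<subseteq> K y ` A"
    if y: "y \<in> carrier G" "y \<notin> A" and y': "y' \<in> carrier G" "y' \<notin> A" and yy': "y \<otimes> y' = y' \<otimes> y" for y y'
  proof
    fix d assume "d \<in> K y' ` A"
    then obtain a where a: "a \<in> A" "d = K y' a" by blast
    have ay: "a \<otimes> y \<in> carrier G" "a \<otimes> y \<notin> A"
      using m_closed[OF Ac[OF a(1)] y(1)] Acan[OF a(1) _ y(1)] y(2) by blast+
    have "centralizer G (a \<otimes> y) \<noteq> A" using self_in_centralizer[OF ay(1)] ay(2) by blast
    then obtain a' where a': "a' \<in> A" "a' \<otimes> y' \<in> centralizer G (a \<otimes> y)"
      using meet[OF cpart_of[OF ay(1) notZ[OF ay(2)]] _ y'] by blast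
    define p where "p = y \<otimes> a' \<otimes> inv y"
    define q where "q = y' \<otimes> a \<otimes> inv y'"
    have pq: "p \<in> A" "q \<in> A" using conjA y y' a a' by (simp_all add: p_def q_def)
    have c: "a \<in> carrier G" "a' \<in> carrier G" "p \<in> carrier G" "q \<in> carrier G"
      using a a' pq Ac by auto
    have "a \<otimes> p \<otimes> (y \<otimes> y') = (a \<otimes> y) \<otimes> (a' \<otimes> y')"
      unfolding p_def using c y y' by (simp add: m_assoc inv_mult_cancel)
    also have "\<dots> = (a' \<otimes> y') \<otimes> (a \<otimes> y)" using a'(2) by (simp add: centralizer_iff)
    also have "\<dots> = a' \<otimes> q \<otimes> (y' \<otimes> y)"
      unfolding q_def using c y y' by (simp add: m_assoc inv_mult_cancel)
    finally have "a \<otimes> p = a' \<otimes> q" using yy' c y y' by simp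
    then have "p = inv a \<otimes> (a' \<otimes> q)" using c by (metis inv_mult_cancel(1))
    then have "inv a' \<otimes> p = inv a' \<otimes> (a' \<otimes> (inv a \<otimes> q))"
      using Acomm[OF Ainv[OF a(1)] a'(1)] c by (simp add: m_assoc[symmetric])
    then have "inv a' \<otimes> p = inv a \<otimes> q" using c by (simp add: inv_mult_cancel)
    then have "d = K y a'" using a(2) by (simp add: K_def p_def q_def)
    then show "d \<in> K y ` A" using a'(1) by blast
  qed
  define D where "D = K b ` A"
  have KB: "K y a \<in> D" if y: "y \<in> B" and a: "a \<in> A" for y a
  proof (cases "y \<in> A")
    case True
    \<comment> \<open>A central y gives only the trivial commutator, which D contains as
      \<open>K b \<one>\<close>.\<close>
    then have "y \<in> Z" using cparts_Int[OF B A BA] y by blast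
    then have ya: "y \<otimes> a = a \<otimes> y" using Ac[OF a] unfolding center_iff by metis
    have "K y a = \<one>" unfolding K_def ya using Ac[OF a] Bc[OF y] by (simp add: m_assoc)
    also have "\<dots> = K b \<one>" using b(1) by (simp add: K_def)
    finally have "K y a = K b \<one>" .
    then show ?thesis unfolding D_def using subgroup.one_closed[OF sA] by blast
  next
    case False
    have "K y ` A \<subseteq> K b ` A" using K_sub[OF b Bc[OF y] False Bcomm[OF bB y]] .
    then show ?thesis using a D_def by blast
  qed
  \<comment> \<open>B is the abelian supplement: a coset of A other than A meets B, so every element
    factors through A and B.\<close>
  have factor: "\<exists>a\<in>A. \<exists>y\<in>B. g = a \<otimes> y" if g: "g \<in> carrier G" for g
  proof (cases "g \<in> A")
    case True
    then show ?thesis using subgroup.one_closed[OF cpart_subgroup[OF B]] g by force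
  next
    case False
    then obtain a where a: "a \<in> A" "a \<otimes> g \<in> B" using meet[OF B BA g] by blast
    then have "g = inv a \<otimes> (a \<otimes> g)" using g Ac by (simp add: inv_mult_cancel)
    then show ?thesis using a Ainv by blast
  qed
  \<comment> \<open>\<open>K b\<close> is an endomorphism of the abelian normal subgroup A. Hence
    its image D is a subgroup, and the fibres of \<open>K b\<close> are cosets of a kernel.\<close>
  have K_mult: "K b (a \<otimes> a') = K b a \<otimes> K b a'" if a: "a \<in> A" "a' \<in> A" for a a'
  proof -
    define p where "p = b \<otimes> a \<otimes> inv b"
    define p' where "p' = b \<otimes> a' \<otimes> inv b"
    have pA: "p \<in> A" "p' \<in> A" using conjA b a by (auto simp: p_def p'_def)
    have c: "a \<in> carrier G" "a' \<in> carrier G" "p \<in> carrier G" "p' \<in> carrier G" using a pA Ac by auto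
    have "b \<otimes> (a \<otimes> a') \<otimes> inv b = p \<otimes> p'"
      using b c by (simp add: p_def p'_def m_assoc inv_mult_cancel)
    then have "K b (a \<otimes> a') = inv a' \<otimes> (inv a \<otimes> p) \<otimes> p'"
      using c by (simp add: K_def inv_mult_group m_assoc)
    also have "\<dots> = (inv a \<otimes> p) \<otimes> inv a' \<otimes> p'"
      using Acomm[OF Ainv[OF a(2)] Amult[OF Ainv[OF a(1)] pA(1)]] by simp
    finally show ?thesis using c by (simp add: K_def p_def[symmetric] p'_def[symmetric] m_assoc)
  qed
  have K_inv: "K b (inv a) = inv (K b a)" if a: "a \<in> A" for a
  proof -
    have "K b (inv a) \<otimes> K b a = K b \<one>" using K_mult[OF Ainv[OF a] a] Ac[OF a] by simp
    also have "\<dots> = \<one>" using b by (simp add: K_def)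
    finally show ?thesis using Ac[OF KA[OF b(1)]] a Ainv by (metis inv_equality)
  qed
  have DA: "D \<subseteq> A" unfolding D_def using KA b by blast
  have sD: "subgroup D G"
  proof (rule subgroupI)
    show "D \<subseteq> carrier G" using DA Ac by blast
    show "D \<noteq> {}" unfolding D_def using subgroup.one_closed[OF sA] by blast
    show "inv d \<in> D" if "d \<in> D" for d
      using that K_inv Ainv unfolding D_def by (auto simp flip: K_inv)
    show "d \<otimes> d' \<in> D" if "d \<in> D" "d' \<in> D" for d d'
      using that K_mult Amult unfolding D_def by (auto simp flip: K_mult)
  qed
  have comm_D: "h \<otimes> h' \<otimes> inv h \<otimes> inv h' \<in> D" if "h \<in> carrier G" "h' \<in> carrier G" for h h'
  proof -
    obtain a y a' y' where f: "a \<in> A" "y \<in> B" "h = a \<otimes> y" "a' \<in> A" "y' \<in> B" "h' = a' \<otimes> y'"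
      using factor \<open>h \<in> carrier G\<close> \<open>h' \<in> carrier G\<close> by metis
    define p where "p = y \<otimes> a' \<otimes> inv y"
    define q where "q = y' \<otimes> inv a \<otimes> inv y'"
    have pq: "p \<in> A" "q \<in> A" using conjA f Bc Ainv by (auto simp: p_def q_def)
    have c: "a \<in> carrier G" "a' \<in> carrier G" "y \<in> carrier G" "y' \<in> carrier G"
      "p \<in> carrier G" "q \<in> carrier G" using f pq Ac Bc by auto
    have yi: "y' \<otimes> inv y = inv y \<otimes> y'"
      using Bcomm[OF f(5) subgroup.m_inv_closed[OF cpart_subgroup[OF B] f(2)]] .
    \<comment> \<open>Since y and y' commute, the commutator can be rearranged into factors from A.
      These commute and regroup as \<open>K y a' \<otimes> K y' (inv a)\<close>, a product of two
      elements of D.\<close>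
    have "a \<otimes> p \<otimes> q \<otimes> inv a' = a \<otimes> y \<otimes> a' \<otimes> (inv y \<otimes> y') \<otimes> inv a \<otimes> inv y' \<otimes> inv a'"
      unfolding p_def q_def using c by (simp add: m_assoc)
    also have "\<dots> = h \<otimes> h' \<otimes> inv h \<otimes> inv h'"
      unfolding f(3,6) yi[symmetric] using c by (simp add: m_assoc inv_mult_group)
    finally have "h \<otimes> h' \<otimes> inv h \<otimes> inv h' = a \<otimes> (p \<otimes> (q \<otimes> inv a'))" using c by (simp add: m_assoc)
    also have "p \<otimes> (q \<otimes> inv a') = (inv a' \<otimes> p) \<otimes> q"
      using Acomm pq Ainv[OF f(4)] Amult c by (metis inv_closed m_assoc)
    also have "a \<otimes> (inv a' \<otimes> p \<otimes> q) = (inv a' \<otimes> p) \<otimes> (a \<otimes> q)"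
      using Acomm[OF f(1) Amult[OF Ainv[OF f(4)] pq(1)]] c by (metis inv_closed m_assoc m_closed)
    also have "\<dots> = K y a' \<otimes> K y' (inv a)" using c by (simp add: K_def p_def q_def)
    finally show ?thesis using subgroup.m_closed[OF sD] KB f Ainv by simp
  qed
  have "derived G (carrier G) = D"
  proof
    show "derived G (carrier G) \<subseteq> D"
      unfolding derived_def using comm_D by (intro generate_subgroup_incl[OF _ sD]) blast
    show "D \<subseteq> derived G (carrier G)"
    proof
      fix d assume "d \<in> D"
      then obtain a where a: "a \<in> A" "d = K b a" unfolding D_def by blast
      then have "d = inv a \<otimes> b \<otimes> inv (inv a) \<otimes> inv b" using b Ac by (simp add: K_def m_assoc)
      then have "d \<in> derived_set G (carrier G)" using a b Ac by blast
      then show "d \<in> derived G (carrier G)" unfolding derived_def by (rule generate.incl)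
    qed
  qed
  \<comment> \<open>The kernel of \<open>K b\<close> on A consists of the elements of A commuting
    with b. It is the intersection of A and B, that is Z, so \<open>K b\<close> has the same fibres
    as \<pi>.\<close>
  moreover have "K b a = K b a' \<longleftrightarrow> \<pi> a = \<pi> a'" if a: "a \<in> A" "a' \<in> A" for a a'
  proof -
    define e where "e = a \<otimes> inv a'"
    have e: "e \<in> A" "e \<in> carrier G" using a Ainv Amult Ac by (auto simp: e_def)
    have Kc: "K b a \<in> carrier G" "K b a' \<in> carrier G" using KA b a Ac by auto
    have "K b a = K b a' \<longleftrightarrow> K b a \<otimes> inv (K b a') = \<one>"
      using Kc by (metis inv_equality inv_inv inv_closed r_inv)
    also have "\<dots> \<longleftrightarrow> K b e = \<one>" using K_mult[OF a(1) Ainv[OF a(2)]] K_inv[OF a(2)] by (simp add: e_def)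
    also have "\<dots> \<longleftrightarrow> e \<in> B"
    proof
      assume "K b e = \<one>"
      then have "e \<otimes> (inv e \<otimes> (b \<otimes> e \<otimes> inv b)) = e" using e by (simp add: K_def)
      then have "b \<otimes> e \<otimes> inv b = e" using e b by (simp add: inv_mult_cancel)
      then have "b \<otimes> e \<otimes> inv b \<otimes> b = e \<otimes> b" by simp
      then show "e \<in> B" using e b by (simp add: B_def centralizer_iff m_assoc)
    next
      assume "e \<in> B"
      then have "b \<otimes> e = e \<otimes> b" using Bcomm bB by blast
      then show "K b e = \<one>" using e b by (simp add: K_def m_assoc inv_mult_cancel)
    qed
    also have "\<dots> \<longleftrightarrow> e \<in> Z" using cparts_Int[OF B A BA] e by blast
    finally show ?thesis using \<pi>_eq_iff[OF Ac[OF a(1)] Ac[OF a(2)]] by (simp add: e_def)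
  qed
  then have bij: "bij_betw (\<lambda>w. K b (inv_into A \<pi> w)) (\<pi> ` A) D"
    unfolding D_def by (rule card_image_eqI)
  moreover have "finite (\<pi> ` A)" using Q.part_finite_card_le(1) A by blast
  ultimately show ?thesis using card bij_betw_same_card[OF bij] bij_betw_finite[OF bij] by simp
qed

end

section \<open>From the number of centralizers to the derived subgroup\<close>

text \<open>The value 1 is that of abelian groups, and 10 is the threshold of
  \<open>nonabelian_centralizer_bound\<close>.\<close>

lemma (in group) abelian_centralizersI:
  assumes "finite (Cent G)" "card (Cent G) \<noteq> 1" "card (Cent G) < 10"
  shows "abelian_centralizers G"
proof
  show "finite (Cent G)" by fact
  show "a \<in> centralizer G b"
    if "x \<in> carrier G" "x \<notin> center G" "a \<in> centralizer G x" "b \<in> centralizer G x" for x a b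
  proof (rule ccontr)
    assume ab: "a \<notin> centralizer G b"
    have "centralizer G x \<noteq> carrier G" using that by (simp add: center_def)
    then obtain g where "g \<in> carrier G" "g \<notin> centralizer G x" using centralizer_subset by blast
    from nonabelian_centralizer_bound[OF assms(1) that(1) this that(3,4) ab] show False
      using assms(3) by simp
  qed
  show "center G \<noteq> carrier G"
  proof
    assume "center G = carrier G"
    then have "Cent G = {carrier G}" unfolding Cent_def center_def using one_closed by blast
    then show False using assms(2) by simp
  qed
qed

theorem proposition3p10:
  fixes G :: "('a, 'b) monoid_scheme" and n :: nat
  assumes "group G"
    and "n \<in> {4, 5, 6, 7, 9}"
    and "n_centralizer n G"
  shows "finite (derived G (carrier G)) \<and> card (derived G (carrier G)) = n - 2"
proof -
  interpret group G by fact
  have fin: "finite (Cent G)" and card: "card (Cent G) = n" using assms(3) by (auto simp: n_centralizer_def)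
  have "card (Cent G) \<noteq> 1" "card (Cent G) < 10" using card assms(2) by auto
  then interpret abelian_centralizers G by (rule abelian_centralizersI[OF fin])
  interpret Q: group_partition "G Mod Z" "(\<lambda>A. \<pi> ` A) ` cparts" by (rule quotient_partition)
  have "card ((\<lambda>A. \<pi> ` A) ` cparts) \<in> {3, 4, 5, 6, 8}"
    unfolding card_quotient_parts card using assms(2) by auto
  \<comment> \<open>One is subtracted for \<open>carrier G\<close>, which is not a member, and one
    more for the extremal cardinality.\<close>
  from Q.ex_large_part[OF this] obtain A where A: "A \<in> cparts" "card (\<pi> ` A) = card (Cent G) - 1 - 1"
    unfolding card_quotient_parts by blast
  then have "card (\<pi> ` A) = card (Cent G) - 2" by simp
  from derived_of_large_part[OF A(1) this] show ?thesis unfolding card .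
qed

end
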